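(* Let $k$ be a field, $S = k[x_1,\ldots,x_n]$, $I \subset S$ a homogeneous ideal, and $0\le t\le n-1$. Let $x_n,x_{n-1},\ldots,x_{n-t}$ be a filter-regular sequence for $S/I$. For $i=0,\ldots,t$ let $g_i$ denote the least common multiple of the minimal (monomial) generators of $\operatorname{in}(I)$ which are not divisible by any of the variables $x_{n-i+1},\ldots,x_n$. Then $$\operatorname{reg}_t(S/I) \le \max\{\deg g_i - n + i \mid i=0,\ldots,t\}.$$
   Context: $S$ is standard graded and $\mathfrak m=(x_1,\ldots,x_n)$. $\operatorname{in}(I)$ denotes the initial ideal of $I$ with respect to the (degree) reverse lexicographic order with $x_1>\cdots>x_n$. The least common multiple of the empty set is $1$. A sequence $z_1,\ldots,z_{t+1}$ of homogeneous elements of $S$ is a filter-regular sequence for $S/I$ if for each $i=0,\ldots,t$, $z_{i+1}\notin\mathfrak p$ for every associated prime $\mathfrak p\ne\mathfrak m$ of $(I,z_1,\ldots,z_i)$. $H^i_{\mathfrak m}(S/I)$ is the $i$th (graded) local cohomology module, $a_i(S/I) := \max\{r \mid H^i_{\mathfrak m}(S/I)_r \ne 0\}$, with $a_i(S/I) = -\infty$ if $H^i_{\mathfrak m}(S/I)=0$, and $\operatorname{reg}_t(S/I) := \max\{a_i(S/I)+i \mid i=0,\ldots,t\}$ (partial regularity). *)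

theory Defs
  imports
    "HOL-Algebra.QuotRing"
    "HOL-Algebra.Module"
    "HOL-Library.Poly_Mapping"
    "HOL-Library.Extended_Real"
begin

section \<open>The polynomial ring and its monomials\<close>

text \<open>
  A monomial is given by its exponent function; the variable with index \<open>i\<close> is \<open>x\<^sub>i\<close>.
  All polynomials in countably many variables form one type; \<open>k[x\<^sub>1, \<dots>, x\<^sub>n]\<close> is the
  subring of those which involve only \<open>x\<^sub>1, \<dots>, x\<^sub>n\<close>.
\<close>

type_synonym mon = "nat \<Rightarrow>\<^sub>0 nat"
type_synonym 'k mpoly = "mon \<Rightarrow>\<^sub>0 'k"

definition mons :: "nat \<Rightarrow> mon set" where
  "mons n = {u. Poly_Mapping.keys u \<subseteq> {1..n}}"

definition mdeg :: "mon \<Rightarrow> nat" where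
  "mdeg u = (\<Sum>i\<in>Poly_Mapping.keys u. Poly_Mapping.lookup u i)"

definition mdvd :: "mon \<Rightarrow> mon \<Rightarrow> bool" where
  "mdvd u v \<longleftrightarrow> (\<forall>i. Poly_Mapping.lookup u i \<le> Poly_Mapping.lookup v i)"

definition mpoly_ring :: "nat \<Rightarrow> ('k::field) mpoly ring" where
  "mpoly_ring n =
     \<lparr>carrier = {f. Poly_Mapping.keys f \<subseteq> mons n}, mult = (*), one = 1, zero = 0, add = (+)\<rparr>"

definition mpoly_of_mon :: "mon \<Rightarrow> ('k::field) mpoly" where
  "mpoly_of_mon u = Poly_Mapping.single u 1"

definition Var :: "nat \<Rightarrow> ('k::field) mpoly" where
  "Var i = mpoly_of_mon (Poly_Mapping.single i 1)"

definition max_ideal :: "nat \<Rightarrow> ('k::field) mpoly set" where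
  "max_ideal n = genideal (mpoly_ring n) (Var ` {1..n})"

text \<open>Degrees are integers; the zero polynomial is homogeneous of every degree.\<close>

definition homogeneous :: "int \<Rightarrow> ('k::field) mpoly \<Rightarrow> bool" where
  "homogeneous r f \<longleftrightarrow> (\<forall>u\<in>Poly_Mapping.keys f. int (mdeg u) = r)"

definition homogeneous_ideal :: "nat \<Rightarrow> ('k::field) mpoly set \<Rightarrow> bool" where
  "homogeneous_ideal n I \<longleftrightarrow>
     ideal I (mpoly_ring n) \<and>
     (\<exists>B \<subseteq> carrier (mpoly_ring n). (\<forall>f\<in>B. \<exists>r. homogeneous r f) \<and> I = genideal (mpoly_ring n) B)"


section \<open>Initial ideals\<close>

text \<open>
  Degree reverse lexicographic order with \<open>x\<^sub>1 > x\<^sub>2 > \<dots>\<close>: among monomials of equal degree,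
  the smaller one has the larger exponent at the last position where the exponents differ.
\<close>

definition revlex_less :: "mon \<Rightarrow> mon \<Rightarrow> bool" where
  "revlex_less u v \<longleftrightarrow>
     mdeg u < mdeg v \<or>
     mdeg u = mdeg v \<and>
       (\<exists>j. Poly_Mapping.lookup v j < Poly_Mapping.lookup u j \<and>
            (\<forall>i>j. Poly_Mapping.lookup u i = Poly_Mapping.lookup v i))"

definition in_mon :: "('k::field) mpoly \<Rightarrow> mon" where
  "in_mon f =
     (THE u. u \<in> Poly_Mapping.keys f \<and> (\<forall>v\<in>Poly_Mapping.keys f. v \<noteq> u \<longrightarrow> revlex_less v u))"

definition init_ideal :: "nat \<Rightarrow> ('k::field) mpoly set \<Rightarrow> 'k mpoly set" where
  "init_ideal n I = genideal (mpoly_ring n) {mpoly_of_mon (in_mon f) | f. f \<in> I \<and> f \<noteq> 0}"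

text \<open>
  The minimal monomial generators of a monomial ideal: the monomials in it that are minimal
  under divisibility.  Lemmas \<open>genideal_min_gens\<close> and \<open>min_gens_least\<close> below show that
  they form the unique minimal monomial generating set.
\<close>

definition min_gens :: "('k::field) mpoly set \<Rightarrow> mon set" where
  "min_gens J =
     {u. (mpoly_of_mon u :: 'k mpoly) \<in> J \<and>
         (\<forall>v. (mpoly_of_mon v :: 'k mpoly) \<in> J \<and> mdvd v u \<longrightarrow> v = u)}"

text \<open>Only meaningful for finite \<open>U\<close>; \<open>0\<close> is inserted so that the empty set has lcm \<open>1\<close>.\<close>

definition mon_lcm :: "mon set \<Rightarrow> mon" where
  "mon_lcm U =
     Poly_Mapping.Abs_poly_mapping (\<lambda>j. Max (insert 0 ((\<lambda>u. Poly_Mapping.lookup u j) ` U)))"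

definition gen_lcm :: "nat \<Rightarrow> ('k::field) mpoly set \<Rightarrow> nat \<Rightarrow> mon" where
  "gen_lcm n I i =
     mon_lcm {u \<in> min_gens (init_ideal n I). \<forall>j\<in>{n - i + 1..n}. \<not> mdvd (Poly_Mapping.single j 1) u}"


section \<open>Associated primes and filter-regular sequences\<close>

definition quot_module :: "('a, 'r) ring_scheme \<Rightarrow> 'a set \<Rightarrow> ('a, 'a set) module" where
  "quot_module R I =
     \<lparr>carrier = carrier (R Quot I), mult = mult (R Quot I), one = one (R Quot I),
      zero = zero (R Quot I), add = add (R Quot I),
      smult = (\<lambda>a X. (I +>\<^bsub>R\<^esub> a) \<otimes>\<^bsub>R Quot I\<^esub> X)\<rparr>"

definition assoc_primes :: "('a, 'r) ring_scheme \<Rightarrow> ('a, 'm, 's) module_scheme \<Rightarrow> 'a set set" where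
  "assoc_primes R M =
     {P. primeideal P R \<and>
         (\<exists>y\<in>carrier M. P = {a \<in> carrier R. a \<odot>\<^bsub>M\<^esub> y = \<zero>\<^bsub>M\<^esub>})}"

text \<open>The associated primes of an ideal \<open>J\<close> are those of the module \<open>S/J\<close>.\<close>

definition filter_regular :: "nat \<Rightarrow> ('k::field) mpoly set \<Rightarrow> 'k mpoly list \<Rightarrow> bool" where
  "filter_regular n I zs \<longleftrightarrow>
     (\<forall>z\<in>set zs. z \<in> carrier (mpoly_ring n) \<and> (\<exists>r. homogeneous r z)) \<and>
     (\<forall>i<length zs.
        \<forall>P \<in> assoc_primes (mpoly_ring n)
                (quot_module (mpoly_ring n) (genideal (mpoly_ring n) (I \<union> set (take i zs)))).
          P \<noteq> max_ideal n \<longrightarrow> zs ! i \<notin> P)"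


section \<open>Localisation of a module at the powers of an element\<close>

text \<open>A pair \<open>(u, k)\<close> stands for the fraction \<open>u / f\<^sup>k\<close>.\<close>

definition loc_rel ::
  "('a, 'r) ring_scheme \<Rightarrow> ('a, 'm, 's) module_scheme \<Rightarrow> 'a \<Rightarrow> (('m \<times> nat) \<times> ('m \<times> nat)) set"
  where
  "loc_rel R M f =
     {((u, k), (v, l)). u \<in> carrier M \<and> v \<in> carrier M \<and>
        (\<exists>j::nat. (f [^]\<^bsub>R\<^esub> (j + l)) \<odot>\<^bsub>M\<^esub> u = (f [^]\<^bsub>R\<^esub> (j + k)) \<odot>\<^bsub>M\<^esub> v)}"

definition frac ::
  "('a, 'r) ring_scheme \<Rightarrow> ('a, 'm, 's) module_scheme \<Rightarrow> 'a \<Rightarrow> 'm \<Rightarrow> nat \<Rightarrow> ('m \<times> nat) set"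
  where
  "frac R M f u k = loc_rel R M f `` {(u, k)}"

text \<open>
  The unions below are over representatives and range over copies of a single class.
  The fields \<open>mult\<close> and \<open>one\<close> of a module record play no role.
\<close>

definition localisation ::
  "('a, 'r) ring_scheme \<Rightarrow> ('a, 'm, 's) module_scheme \<Rightarrow> 'a \<Rightarrow> ('a, ('m \<times> nat) set) module"
  where
  "localisation R M f =
     \<lparr>carrier = (carrier M \<times> UNIV) // loc_rel R M f,
      mult = undefined, one = undefined,
      zero = frac R M f \<zero>\<^bsub>M\<^esub> 0,
      add = (\<lambda>X Y. \<Union>(u, k)\<in>X. \<Union>(v, l)\<in>Y.
               frac R M f ((f [^]\<^bsub>R\<^esub> l) \<odot>\<^bsub>M\<^esub> u \<oplus>\<^bsub>M\<^esub> (f [^]\<^bsub>R\<^esub> k) \<odot>\<^bsub>M\<^esub> v) (k + l)),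
      smult = (\<lambda>a X. \<Union>(u, k)\<in>X. frac R M f (a \<odot>\<^bsub>M\<^esub> u) k)\<rparr>"

text \<open>The canonical map \<open>M\<^sub>f \<rightarrow> M\<^sub>h\<close> for \<open>h = f g\<close>, sending \<open>u / f\<^sup>k\<close> to \<open>g\<^sup>k u / h\<^sup>k\<close>.\<close>

definition loc_map ::
  "('a, 'r) ring_scheme \<Rightarrow> ('a, 'm, 's) module_scheme \<Rightarrow> 'a \<Rightarrow> 'a \<Rightarrow> ('m \<times> nat) set \<Rightarrow> ('m \<times> nat) set"
  where
  "loc_map R M g h X = (\<Union>(u, k)\<in>X. frac R M h ((g [^]\<^bsub>R\<^esub> k) \<odot>\<^bsub>M\<^esub> u) k)"

text \<open>The degree \<open>r\<close> part of \<open>M\<^sub>f\<close>, for \<open>M\<close> graded by \<open>gr\<close> and \<open>f\<close> homogeneous of degree \<open>d\<close>.\<close>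

definition loc_comp ::
  "('a, 'r) ring_scheme \<Rightarrow> ('a, 'm, 's) module_scheme \<Rightarrow> (int \<Rightarrow> 'm set) \<Rightarrow> 'a \<Rightarrow> nat \<Rightarrow> int
     \<Rightarrow> ('m \<times> nat) set set"
  where
  "loc_comp R M gr f d r = {frac R M f u k | u k. u \<in> gr (r + int k * int d)}"


section \<open>Graded local cohomology\<close>

text \<open>
  Local cohomology of a graded module \<open>M\<close> (with graded components \<open>gr r\<close>) with support in the
  ideal generated by elements \<open>x 1, \<dots>, x n\<close> of degree 1 is the cohomology of the Cech complex
  whose term in cohomological degree \<open>p\<close> is the product of the localisations of \<open>M\<close> at
  \<open>\<Prod>i\<in>F. x i\<close> over all \<open>p\<close>-element subsets \<open>F\<close> of \<open>{1..n}\<close>.  The complex is a complex of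
  graded modules; everything is defined here for its strand of internal degree \<open>r\<close>.
\<close>

definition faces :: "nat \<Rightarrow> nat \<Rightarrow> nat set set" where
  "faces n p = {F. F \<subseteq> {1..n} \<and> card F = p}"

definition loc_at ::
  "('a, 'r) ring_scheme \<Rightarrow> ('a, 'm, 's) module_scheme \<Rightarrow> (nat \<Rightarrow> 'a) \<Rightarrow> nat set
     \<Rightarrow> ('a, ('m \<times> nat) set) module"
  where
  "loc_at R M x F = localisation R M (\<Otimes>\<^bsub>R\<^esub>i\<in>F. x i)"

definition cech ::
  "('a, 'r) ring_scheme \<Rightarrow> ('a, 'm, 's) module_scheme \<Rightarrow> (int \<Rightarrow> 'm set) \<Rightarrow> (nat \<Rightarrow> 'a) \<Rightarrow> nat
     \<Rightarrow> nat \<Rightarrow> int \<Rightarrow> (nat set \<Rightarrow> ('m \<times> nat) set) monoid"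
  where
  "cech R M gr x n p r =
     \<lparr>carrier = (\<Pi>\<^sub>E F\<in>faces n p. loc_comp R M gr (\<Otimes>\<^bsub>R\<^esub>i\<in>F. x i) (card F) r),
      mult = (\<lambda>b c. \<lambda>F\<in>faces n p. b F \<oplus>\<^bsub>loc_at R M x F\<^esub> c F),
      one = (\<lambda>F\<in>faces n p. \<zero>\<^bsub>loc_at R M x F\<^esub>)\<rparr>"

definition cech_d ::
  "('a, 'r) ring_scheme \<Rightarrow> ('a, 'm, 's) module_scheme \<Rightarrow> (nat \<Rightarrow> 'a) \<Rightarrow> nat \<Rightarrow> nat
     \<Rightarrow> (nat set \<Rightarrow> ('m \<times> nat) set) \<Rightarrow> (nat set \<Rightarrow> ('m \<times> nat) set)"
  where
  "cech_d R M x n p c =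
     (\<lambda>G\<in>faces n (Suc p).
        \<Oplus>\<^bsub>loc_at R M x G\<^esub>j\<in>G.
          ((\<ominus>\<^bsub>R\<^esub> \<one>\<^bsub>R\<^esub>) [^]\<^bsub>R\<^esub> card {i \<in> G. i < j})
            \<odot>\<^bsub>loc_at R M x G\<^esub> loc_map R M (x j) (\<Otimes>\<^bsub>R\<^esub>i\<in>G. x i) (c (G - {j})))"

definition cocycles where
  "cocycles R M gr x n p r =
     {c \<in> carrier (cech R M gr x n p r). cech_d R M x n p c = one (cech R M gr x n (Suc p) r)}"

definition coboundaries where
  "coboundaries R M gr x n p r =
     (case p of
        0 \<Rightarrow> {one (cech R M gr x n 0 r)}
      | Suc q \<Rightarrow> cech_d R M x n q ` carrier (cech R M gr x n q r))"

definition local_cohomology ::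
  "('a, 'r) ring_scheme \<Rightarrow> ('a, 'm, 's) module_scheme \<Rightarrow> (int \<Rightarrow> 'm set) \<Rightarrow> (nat \<Rightarrow> 'a) \<Rightarrow> nat
     \<Rightarrow> nat \<Rightarrow> int \<Rightarrow> (nat set \<Rightarrow> ('m \<times> nat) set) set monoid"
  where
  "local_cohomology R M gr x n p r =
     (cech R M gr x n p r)\<lparr>carrier := cocycles R M gr x n p r\<rparr> Mod coboundaries R M gr x n p r"


section \<open>Partial regularity of \<open>S/I\<close>\<close>

definition quot_comp :: "nat \<Rightarrow> ('k::field) mpoly set \<Rightarrow> int \<Rightarrow> 'k mpoly set set" where
  "quot_comp n I r =
     {I +>\<^bsub>mpoly_ring n\<^esub> f | f. f \<in> carrier (mpoly_ring n) \<and> homogeneous r f}"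

definition H_m ::
  "nat \<Rightarrow> ('k::field) mpoly set \<Rightarrow> nat \<Rightarrow> int \<Rightarrow> (nat set \<Rightarrow> ('k mpoly set \<times> nat) set) set monoid"
  where
  "H_m n I i r =
     local_cohomology (mpoly_ring n) (quot_module (mpoly_ring n) I) (quot_comp n I) Var n i r"

text \<open>
  As a supremum in the extended reals this is \<open>-\<infinity>\<close> if the cohomology module vanishes, the maximum
  if it exists, and \<open>\<infinity>\<close> if the nonzero degrees are unbounded above.
\<close>

definition a_inv_coh :: "nat \<Rightarrow> ('k::field) mpoly set \<Rightarrow> nat \<Rightarrow> ereal" where
  "a_inv_coh n I i = (SUP r\<in>{r. carrier (H_m n I i r) \<noteq> {one (H_m n I i r)}}. ereal (of_int r))"

definition reg_partial :: "nat \<Rightarrow> ('k::field) mpoly set \<Rightarrow> nat \<Rightarrow> ereal" where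
  "reg_partial n I t = Max ((\<lambda>i. a_inv_coh n I i + ereal (real i)) ` {0..t})"


section \<open>Minimal monomial generators\<close>

lemma mpoly_ring_cring: "cring (mpoly_ring n :: ('k::field) mpoly ring)"
proof -
  have add: "f + g \<in> carrier (mpoly_ring n)"
    if "f \<in> carrier (mpoly_ring n)" "g \<in> carrier (mpoly_ring n)" for f g :: "'k mpoly"
    using that Poly_Mapping.keys_add[of f g] by (auto simp: mpoly_ring_def)
  have mult: "f * g \<in> carrier (mpoly_ring n)"
    if "f \<in> carrier (mpoly_ring n)" "g \<in> carrier (mpoly_ring n)" for f g :: "'k mpoly"
  proof -
    have "u + v \<in> mons n" if "u \<in> mons n" "v \<in> mons n" for u v
      using that Poly_Mapping.keys_add[of u v] by (auto simp: mons_def)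
    then show ?thesis
      using that Poly_Mapping.keys_mult[of f g] by (fastforce simp: mpoly_ring_def)
  qed
  show ?thesis
  proof (intro cringI abelian_groupI comm_monoidI)
    fix f :: "'k mpoly" assume "f \<in> carrier (mpoly_ring n)"
    then show "\<exists>g\<in>carrier (mpoly_ring n). g \<oplus>\<^bsub>mpoly_ring n\<^esub> f = \<zero>\<^bsub>mpoly_ring n\<^esub>"
      by (intro bexI[of _ "- f"]) (auto simp: mpoly_ring_def)
  qed (use add mult in \<open>auto simp: mpoly_ring_def mons_def algebra_simps\<close>)
qed

lemma mem_genideal_mons:
  assumes U: "U \<subseteq> mons n" and f: "f \<in> genideal (mpoly_ring n) (mpoly_of_mon ` U)"
    and w: "w \<in> Poly_Mapping.keys (f :: ('k::field) mpoly)"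
  shows "\<exists>u\<in>U. mdvd u w"
proof -
  interpret R: cring "mpoly_ring n :: 'k mpoly ring" by (rule mpoly_ring_cring)
  let ?J = "{f \<in> carrier (mpoly_ring n) :: 'k mpoly set.
               \<forall>w\<in>Poly_Mapping.keys f. \<exists>u\<in>U. mdvd u w}"
  have mult: "g * f \<in> ?J" if f: "f \<in> ?J" and g: "g \<in> carrier (mpoly_ring n)" for f g
  proof -
    have "g * f \<in> carrier (mpoly_ring n)"
      using R.m_closed[OF g] f by (auto simp: mpoly_ring_def)
    moreover have "\<exists>u\<in>U. mdvd u w" if wk: "w \<in> Poly_Mapping.keys (g * f)" for w
    proof -
      obtain a b where w: "w = a + b" and b: "b \<in> Poly_Mapping.keys f"
        using subsetD[OF Poly_Mapping.keys_mult wk] by auto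
      from b f obtain u where "u \<in> U" "mdvd u b" by blast
      moreover from this(2) have "mdvd u w"
        by (simp add: w mdvd_def lookup_add trans_le_add2)
      ultimately show ?thesis by blast
    qed
    ultimately show ?thesis by blast
  qed
  have "ideal ?J (mpoly_ring n)"
  proof (rule idealI)
    show "subgroup ?J (add_monoid (mpoly_ring n))"
    proof (rule R.add.subgroupI)
      show "?J \<noteq> {}" by (auto simp: mpoly_ring_def intro!: exI[of _ 0])
    next
      fix a assume a: "a \<in> ?J"
      then have "\<ominus>\<^bsub>mpoly_ring n\<^esub> a = - a"
        by (intro R.minus_equality) (auto simp: mpoly_ring_def)
      then show "\<ominus>\<^bsub>mpoly_ring n\<^esub> a \<in> ?J"
        using a by (auto simp: mpoly_ring_def)
    next
      fix a b assume "a \<in> ?J" "b \<in> ?J"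
      then show "a \<oplus>\<^bsub>mpoly_ring n\<^esub> b \<in> ?J"
        using Poly_Mapping.keys_add[of a b] by (auto simp: mpoly_ring_def)
    qed auto
  next
    fix a x :: "'k mpoly" assume "a \<in> ?J" "x \<in> carrier (mpoly_ring n)"
    from mult[OF this] show "x \<otimes>\<^bsub>mpoly_ring n\<^esub> a \<in> ?J" "a \<otimes>\<^bsub>mpoly_ring n\<^esub> x \<in> ?J"
      by (simp_all add: mpoly_ring_def mult.commute)
  qed (rule R.ring_axioms)
  moreover have "mpoly_of_mon ` U \<subseteq> ?J"
    using U by (auto simp: mpoly_of_mon_def mpoly_ring_def mdvd_def)
  ultimately have "genideal (mpoly_ring n) (mpoly_of_mon ` U) \<subseteq> ?J"
    by (rule R.genideal_minimal)
  then show ?thesis using f w by blast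
qed

lemma mdvd_mdeg: "mdvd u v \<Longrightarrow> u \<noteq> v \<Longrightarrow> mdeg u < mdeg v"
proof -
  assume d: "mdvd u v" and ne: "u \<noteq> v"
  let ?A = "Poly_Mapping.keys u \<union> Poly_Mapping.keys v"
  have deg: "mdeg w = (\<Sum>i\<in>?A. Poly_Mapping.lookup w i)" if "Poly_Mapping.keys w \<subseteq> ?A" for w
    unfolding mdeg_def using that by (intro sum.mono_neutral_left) (auto simp: in_keys_iff)
  obtain i where "Poly_Mapping.lookup u i \<noteq> Poly_Mapping.lookup v i"
    by (metis ne poly_mapping_eqI)
  moreover from this have "i \<in> ?A" by (auto simp: in_keys_iff)
  ultimately have "\<exists>i\<in>?A. Poly_Mapping.lookup u i < Poly_Mapping.lookup v i"
    using d unfolding mdvd_def by (meson le_neq_implies_less)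
  then have "(\<Sum>i\<in>?A. Poly_Mapping.lookup u i) < (\<Sum>i\<in>?A. Poly_Mapping.lookup v i)"
    using d unfolding mdvd_def by (intro sum_strict_mono_ex1) auto
  then show ?thesis by (simp add: deg)
qed

lemma mem_min_gens:
  assumes "(mpoly_of_mon w :: ('k::field) mpoly) \<in> J"
  shows "\<exists>u\<in>min_gens J. mdvd u w"
  using assms
proof (induction "mdeg w" arbitrary: w rule: less_induct)
  case less
  show ?case
  proof (cases "w \<in> min_gens J")
    case True
    then show ?thesis by (auto simp: mdvd_def)
  next
    case False
    then obtain v where "(mpoly_of_mon v :: 'k mpoly) \<in> J" "mdvd v w" "v \<noteq> w"
      using less.prems by (auto simp: min_gens_def)
    with less.hyps[of v] mdvd_mdeg[of v w] obtain u where "u \<in> min_gens J" "mdvd u v" by blast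
    moreover from this(2) \<open>mdvd v w\<close> have "mdvd u w"
      unfolding mdvd_def by (meson order_trans)
    ultimately show ?thesis by blast
  qed
qed

lemma min_gens_least:
  assumes U: "U \<subseteq> mons n" and J: "J = genideal (mpoly_ring n) (mpoly_of_mon ` U)"
  shows "min_gens (J :: ('k::field) mpoly set) \<subseteq> U"
proof
  interpret R: cring "mpoly_ring n :: 'k mpoly ring" by (rule mpoly_ring_cring)
  fix w assume w: "w \<in> min_gens J"
  then obtain u where u: "u \<in> U" "mdvd u w"
    using mem_genideal_mons[OF U, of "mpoly_of_mon w :: 'k mpoly" w] J
    by (auto simp: min_gens_def mpoly_of_mon_def)
  have "mpoly_of_mon ` U \<subseteq> (carrier (mpoly_ring n) :: 'k mpoly set)"
    using U by (auto simp: mpoly_of_mon_def mpoly_ring_def)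
  then have "(mpoly_of_mon u :: 'k mpoly) \<in> J"
    using J u R.genideal_self by blast
  with u w show "w \<in> U" by (auto simp: min_gens_def)
qed

lemma genideal_min_gens:
  assumes U: "U \<subseteq> mons n" and J: "J = genideal (mpoly_ring n) (mpoly_of_mon ` U)"
  shows "genideal (mpoly_ring n) (mpoly_of_mon ` min_gens J) = (J :: ('k::field) mpoly set)"
proof -
  interpret R: cring "mpoly_ring n :: 'k mpoly ring" by (rule mpoly_ring_cring)
  let ?G = "genideal (mpoly_ring n) (mpoly_of_mon ` min_gens J) :: 'k mpoly set"
  have inR: "mpoly_of_mon ` A \<subseteq> (carrier (mpoly_ring n) :: 'k mpoly set)" if "A \<subseteq> mons n" for A
    using that by (auto simp: mpoly_of_mon_def mpoly_ring_def)
  have mU: "min_gens J \<subseteq> U" using U J by (rule min_gens_least)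
  have idJ: "ideal J (mpoly_ring n)" unfolding J using inR[OF U] by (rule R.genideal_ideal)
  have idG: "ideal ?G (mpoly_ring n)" using inR[of "min_gens J"] mU U by (intro R.genideal_ideal) blast
  have "?G \<subseteq> J" by (rule R.genideal_minimal[OF idJ]) (auto simp: min_gens_def)
  moreover have "J \<subseteq> ?G"
    unfolding J
  proof (rule R.genideal_minimal, fold J, rule idG, safe)
    fix w assume w: "w \<in> U"
    have "(mpoly_of_mon w :: 'k mpoly) \<in> J"
      using w R.genideal_self[OF inR[OF U]] J by blast
    then obtain u where u: "u \<in> min_gens J" "mdvd u w" using mem_min_gens by blast
    define v where "v = w - u"
    have v: "w = v + u"
      using u(2) by (intro poly_mapping_eqI) (simp add: v_def mdvd_def lookup_add lookup_minus)
    have "Poly_Mapping.keys v \<subseteq> Poly_Mapping.keys w"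
      by (auto simp: v in_keys_iff lookup_add)
    with w U have "v \<in> mons n" by (auto simp: mons_def)
    then have "(mpoly_of_mon v :: 'k mpoly) \<in> carrier (mpoly_ring n)"
      by (auto simp: mpoly_of_mon_def mpoly_ring_def)
    moreover have "(mpoly_of_mon u :: 'k mpoly) \<in> ?G"
      using u R.genideal_self[OF inR] mU U by blast
    ultimately have "mpoly_of_mon v \<otimes>\<^bsub>mpoly_ring n\<^esub> mpoly_of_mon u \<in> ?G"
      using ideal.I_l_closed[OF idG] by blast
    also have "mpoly_of_mon v \<otimes>\<^bsub>mpoly_ring n\<^esub> mpoly_of_mon u = (mpoly_of_mon w :: 'k mpoly)"
      by (simp add: mpoly_ring_def mpoly_of_mon_def v mult_single)
    finally show "(mpoly_of_mon w :: 'k mpoly) \<in> ?G" .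
  qed
  ultimately show ?thesis by blast
qed

end

(*
  Everything is computed on representatives in the polynomial ring. A Cech cochain of S/J of
  internal degree r is a family of fractions u_F / x_F^K with one common K, and after clearing
  denominators the Cech differential is a signed sum delta_K on polynomial families.

  Let Q_i = I + (x_n, ..., x_{n-i+1}) and let B be the right-hand side. First, if
  x_{n-i} f lies in Q_i for a homogeneous f of degree above B, then f lies in Q_i. For otherwise,
  reduce f modulo Q_i so that its leading monomial u is not one of Q_i; filter-regularity gives
  x_j^N f in Q_i for all j, so x_j^N u is a leading monomial of Q_i in x_1, ..., x_{n-i} and
  hence, by the choice of the order, of I. A minimal generator dividing it has a larger exponent
  at j than u, for every j <= n - i, so deg f = deg u <= deg g_i - (n - i).
  Second, this injectivity in degrees above B gives H^p(S/Q_i)_r = 0 for p + i <= t and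
  r + p > B, by induction on p through the long exact sequence of multiplication by x_{n-i},
  every local cohomology class being killed by a power of x_{n-i}.
*)

theory Submission
  imports Defs
begin

text \<open>The bound B matters only on the empty face. On a nonempty face F a numerator and its
  denominator can both be multiplied by a power of x_F, which raises the degree of the numerator
  without changing the fraction; so injectivity of x_{n-i} on S/Q_i in degrees above B already makes
  x_{n-i} injective on the localisation at x_F in every degree. In positive cohomological degree the
  condition r + p > B is therefore felt only through S/Q_{i+1}, and that passage lowers p by one,
  raises the internal degree by one and preserves r + p. It ends at p = 0, where S/Q_{i+p} itself is
  tested in degree r + p. A class with common denominator exponent K is killed by x_{n-i}^K, because
  the Cech complex has a contracting homotopy once x_{n-i} is inverted. On numerators this homotopy
  is an identity between polynomials that costs exactly the factor x_{n-i}^K. Equality of fractions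
  holds only up to further powers of x_F, so every relation carries an exponent by which
  denominators may still grow; as there are finitely many faces, one exponent always serves for all
  of them.\<close>

section \<open>Polynomials and their homogeneous components\<close>

abbreviation polys :: "nat \<Rightarrow> ('k::field) mpoly set" where
  "polys n \<equiv> carrier (mpoly_ring n)"

lemma mpoly_ring_simps [simp]:
  "mult (mpoly_ring n) = (*)" "add (mpoly_ring n) = (+)"
  "one (mpoly_ring n) = 1" "zero (mpoly_ring n) = 0"
  by (simp_all add: mpoly_ring_def)

lemma mem_polys: "f \<in> polys n \<longleftrightarrow> Poly_Mapping.keys f \<subseteq> mons n"
  by (simp add: mpoly_ring_def)

lemma mons_add: "u + v \<in> mons n \<longleftrightarrow> u \<in> mons n \<and> v \<in> mons n"
proof -
  have "Poly_Mapping.keys (u + v) = Poly_Mapping.keys u \<union> Poly_Mapping.keys v"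
    by (auto simp: in_keys_iff lookup_add)
  then show ?thesis by (simp add: mons_def)
qed

lemma zero_mons [simp]: "0 \<in> mons n"
  by (simp add: mons_def)

lemma mdvd_add_diff: "mdvd w v \<Longrightarrow> w + (v - w) = v"
  by (intro poly_mapping_eqI) (simp add: mdvd_def lookup_add lookup_minus)

lemma polys_closed [simp, intro]:
  fixes f g :: "('k::field) mpoly"
  shows "(0 :: 'k mpoly) \<in> polys n" "(1 :: 'k mpoly) \<in> polys n"
    and "f \<in> polys n \<Longrightarrow> g \<in> polys n \<Longrightarrow> f + g \<in> polys n"
    and "f \<in> polys n \<Longrightarrow> g \<in> polys n \<Longrightarrow> f * g \<in> polys n"
    and "f \<in> polys n \<Longrightarrow> - f \<in> polys n"
    and "f \<in> polys n \<Longrightarrow> g \<in> polys n \<Longrightarrow> f - g \<in> polys n"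
proof -
  interpret R: cring "mpoly_ring n :: 'k mpoly ring" by (rule mpoly_ring_cring)
  show "0 \<in> (polys n :: 'k mpoly set)" "1 \<in> (polys n :: 'k mpoly set)" by (simp_all add: mem_polys)
  show "f \<in> polys n \<Longrightarrow> g \<in> polys n \<Longrightarrow> f * g \<in> polys n" using R.m_closed[of f g] by simp
  show add: "f \<in> polys n \<Longrightarrow> g \<in> polys n \<Longrightarrow> f + g \<in> polys n" for f g :: "'k mpoly"
    using R.a_closed[of f g] by simp
  show neg: "f \<in> polys n \<Longrightarrow> - f \<in> polys n" for f :: "'k mpoly"
    by (simp add: mem_polys subset_iff in_keys_iff)
  show "f \<in> polys n \<Longrightarrow> g \<in> polys n \<Longrightarrow> f - g \<in> polys n"
    using add[OF _ neg, of f g] by simp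
qed

lemma polys_sum [intro]: "(\<And>i. i \<in> A \<Longrightarrow> f i \<in> polys n) \<Longrightarrow> sum f A \<in> polys n"
  by (induction A rule: infinite_finite_induct) auto

lemma polys_prod [intro]: "(\<And>i. i \<in> A \<Longrightarrow> f i \<in> polys n) \<Longrightarrow> prod f A \<in> polys n"
  by (induction A rule: infinite_finite_induct) auto

lemma polys_power [simp, intro]: "f \<in> polys n \<Longrightarrow> f ^ m \<in> polys n"
  by (induction m) auto

lemma single_polys [simp]: "u \<in> mons n \<Longrightarrow> Poly_Mapping.single u c \<in> polys n"
  by (simp add: mem_polys)

lemma Var_polys [simp]: "i \<in> {1..n} \<Longrightarrow> Var i \<in> polys n"
  by (simp add: Var_def mpoly_of_mon_def mons_def)

lemma lookup_single_mult:
  "Poly_Mapping.lookup (Poly_Mapping.single w c * f) v =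
     (if mdvd w v then c * Poly_Mapping.lookup f (v - w) else 0)"
  for f :: "('k::field) mpoly"
proof -
  have "Poly_Mapping.lookup (Poly_Mapping.single w c * f) v =
      Sum_any (\<lambda>l. (c when w = l) * Sum_any (\<lambda>q. Poly_Mapping.lookup f q when v = l + q))"
    by (simp add: lookup_mult lookup_single)
  also have "\<dots> = Sum_any (\<lambda>l. (c * Sum_any (\<lambda>q. Poly_Mapping.lookup f q when v = l + q)) when w = l)"
    by (simp add: when_mult)
  also have "\<dots> = c * Sum_any (\<lambda>q. Poly_Mapping.lookup f q when v = w + q)"
    by simp
  also have "\<dots> = (if mdvd w v then c * Poly_Mapping.lookup f (v - w) else 0)"
  proof (cases "mdvd w v")
    case True
    then have "v = w + q \<longleftrightarrow> v - w = q" for q by (metis add_diff_cancel_left' mdvd_add_diff)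
    then show ?thesis using True by simp
  next
    case False
    then have "v \<noteq> w + q" for q by (auto simp: mdvd_def lookup_add)
    then show ?thesis using False by simp
  qed
  finally show ?thesis .
qed

lemma mdvd_self_add [simp]: "mdvd w (w + v)"
  by (simp add: mdvd_def lookup_add)

lemma keys_single_mult:
  fixes f :: "('k::field) mpoly"
  assumes "c \<noteq> 0"
  shows "Poly_Mapping.keys (Poly_Mapping.single w c * f) = (+) w ` Poly_Mapping.keys f"
proof (intro equalityI subsetI)
  fix v
  assume "v \<in> Poly_Mapping.keys (Poly_Mapping.single w c * f)"
  then have "mdvd w v" "v - w \<in> Poly_Mapping.keys f"
    by (auto simp: in_keys_iff lookup_single_mult split: if_splits)
  then show "v \<in> (+) w ` Poly_Mapping.keys f"
    by (metis image_eqI mdvd_add_diff)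
qed (use assms in \<open>auto simp: in_keys_iff lookup_single_mult\<close>)

lemma mpoly_sum_single:
  "f = (\<Sum>u\<in>Poly_Mapping.keys f. Poly_Mapping.single u (Poly_Mapping.lookup f u))"
  by (rule poly_mapping_eqI) (auto simp: lookup_sum lookup_single when_def in_keys_iff)

lemma mdeg_eq: "finite A \<Longrightarrow> Poly_Mapping.keys u \<subseteq> A \<Longrightarrow> mdeg u = (\<Sum>i\<in>A. Poly_Mapping.lookup u i)"
  unfolding mdeg_def by (intro sum.mono_neutral_left) (auto simp: in_keys_iff)

lemma mdeg_add [simp]: "mdeg (u + v) = mdeg u + mdeg v"
proof -
  let ?A = "Poly_Mapping.keys u \<union> Poly_Mapping.keys v"
  show ?thesis
    using mdeg_eq[of ?A u] mdeg_eq[of ?A v] mdeg_eq[of ?A "u + v"] Poly_Mapping.keys_add[of u v]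
    by (simp add: lookup_add sum.distrib)
qed

lemma mdeg_single [simp]: "mdeg (Poly_Mapping.single i e) = e"
  by (simp add: mdeg_def)

lemma homogeneous_0 [simp]: "homogeneous r 0"
  by (simp add: homogeneous_def)

lemma homogeneous_add [intro]: "homogeneous r f \<Longrightarrow> homogeneous r g \<Longrightarrow> homogeneous r (f + g)"
  using Poly_Mapping.keys_add[of f g] by (auto simp: homogeneous_def)

lemma homogeneous_uminus [intro]: "homogeneous r f \<Longrightarrow> homogeneous r (- f)"
  by (auto simp: homogeneous_def in_keys_iff)

lemma homogeneous_diff [intro]: "homogeneous r f \<Longrightarrow> homogeneous r g \<Longrightarrow> homogeneous r (f - g)"
  using homogeneous_add[of r f "- g"] by auto

lemma homogeneous_sum [intro]: "(\<And>i. i \<in> A \<Longrightarrow> homogeneous r (f i)) \<Longrightarrow> homogeneous r (sum f A)"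
  by (induction A rule: infinite_finite_induct) auto

lemma homogeneous_mult: "homogeneous r f \<Longrightarrow> homogeneous s g \<Longrightarrow> homogeneous (r + s) (f * g)"
  using Poly_Mapping.keys_mult[of f g] by (fastforce simp: homogeneous_def)

lemma homogeneous_power: "homogeneous r f \<Longrightarrow> homogeneous (int m * r) (f ^ m)"
proof (induction m)
  case (Suc m)
  then show ?case using homogeneous_mult[of r f "int m * r" "f ^ m"] by (simp add: algebra_simps)
qed (simp add: homogeneous_def mdeg_def)

lemma homogeneous_prod:
  "(\<And>i. i \<in> A \<Longrightarrow> homogeneous 1 (f i)) \<Longrightarrow> finite A \<Longrightarrow> homogeneous (int (card A)) (prod f A)"
proof (induction A rule: infinite_finite_induct)
  case (insert x A)
  then show ?case using homogeneous_mult[of 1 "f x" "int (card A)" "prod f A"] by (simp add: algebra_simps)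
qed (simp_all add: homogeneous_def mdeg_def)

lemma homogeneous_Var [simp]: "homogeneous 1 (Var i)"
  by (simp add: homogeneous_def Var_def mpoly_of_mon_def)

definition hcomp :: "int \<Rightarrow> ('k::field) mpoly \<Rightarrow> 'k mpoly" where
  "hcomp r f = Poly_Mapping.Abs_poly_mapping (\<lambda>u. Poly_Mapping.lookup f u when int (mdeg u) = r)"

lemma lookup_hcomp:
  "Poly_Mapping.lookup (hcomp r f) u = (Poly_Mapping.lookup f u when int (mdeg u) = r)"
proof -
  have "{u. (Poly_Mapping.lookup f u when int (mdeg u) = r) \<noteq> 0} \<subseteq> Poly_Mapping.keys f"
    by (auto simp: in_keys_iff)
  then show ?thesis
    unfolding hcomp_def by (subst lookup_Abs_poly_mapping) (auto intro: finite_subset)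
qed

lemma keys_hcomp: "Poly_Mapping.keys (hcomp r f) = {u \<in> Poly_Mapping.keys f. int (mdeg u) = r}"
  by (auto simp: in_keys_iff lookup_hcomp)

lemma hcomp_polys [intro]: "f \<in> polys n \<Longrightarrow> hcomp r f \<in> polys n"
  by (auto simp: mem_polys keys_hcomp)

lemma homogeneous_hcomp [simp]: "homogeneous r (hcomp r f)"
  by (auto simp: homogeneous_def keys_hcomp)

lemma hcomp_add: "hcomp r (f + g) = hcomp r f + hcomp r g"
  by (rule poly_mapping_eqI) (simp add: lookup_hcomp lookup_add when_add_distrib)

lemma hcomp_0 [simp]: "hcomp r 0 = 0"
  by (rule poly_mapping_eqI) (simp add: lookup_hcomp)

lemma hcomp_uminus: "hcomp r (- f) = - hcomp r f"
  by (rule poly_mapping_eqI) (simp add: lookup_hcomp when_def)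

lemma hcomp_sum: "hcomp r (sum f A) = (\<Sum>i\<in>A. hcomp r (f i))"
  by (induction A rule: infinite_finite_induct) (simp_all add: hcomp_add)

lemma hcomp_homogeneous: "homogeneous s f \<Longrightarrow> hcomp r f = (if r = s then f else 0)"
  by (rule poly_mapping_eqI) (auto simp: lookup_hcomp homogeneous_def when_def in_keys_iff)

lemma hcomp_single_mult:
  "hcomp r (Poly_Mapping.single w c * f) = Poly_Mapping.single w c * hcomp (r - int (mdeg w)) f"
proof (rule poly_mapping_eqI)
  fix v
  show "Poly_Mapping.lookup (hcomp r (Poly_Mapping.single w c * f)) v =
      Poly_Mapping.lookup (Poly_Mapping.single w c * hcomp (r - int (mdeg w)) f) v"
  proof (cases "mdvd w v")
    case True
    then have "mdeg v = mdeg w + mdeg (v - w)" by (metis mdeg_add mdvd_add_diff)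
    with True show ?thesis by (auto simp: lookup_hcomp lookup_single_mult when_def)
  qed (simp add: lookup_hcomp lookup_single_mult)
qed

lemma hcomp_Var_mult: "hcomp r (Var i * f) = Var i * hcomp (r - 1) f"
  by (simp add: Var_def mpoly_of_mon_def hcomp_single_mult)


section \<open>Homogeneous ideals\<close>

lemma ideal_polysD:
  assumes "ideal J (mpoly_ring n)"
  shows "J \<subseteq> polys n" "0 \<in> J"
    and "f \<in> J \<Longrightarrow> g \<in> J \<Longrightarrow> f + g \<in> J"
    and "f \<in> J \<Longrightarrow> - f \<in> J"
    and "f \<in> J \<Longrightarrow> g \<in> J \<Longrightarrow> f - g \<in> J"
    and "f \<in> J \<Longrightarrow> h \<in> polys n \<Longrightarrow> h * f \<in> J"
    and "f \<in> J \<Longrightarrow> h \<in> polys n \<Longrightarrow> f * h \<in> J"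
    and "(\<And>i. i \<in> A \<Longrightarrow> F i \<in> J) \<Longrightarrow> sum F A \<in> J"
proof -
  interpret ideal J "mpoly_ring n :: 'a mpoly ring" by fact
  show "J \<subseteq> polys n" using a_subset by auto
  show 0: "0 \<in> J" using additive_subgroup.zero_closed[OF additive_subgroup_axioms] by simp
  show add: "f \<in> J \<Longrightarrow> g \<in> J \<Longrightarrow> f + g \<in> J" for f g
    using additive_subgroup.a_closed[OF additive_subgroup_axioms, of f g] by simp
  show mult: "f \<in> J \<Longrightarrow> h \<in> polys n \<Longrightarrow> h * f \<in> J" for f h using I_l_closed[of f h] by simp
  show "f \<in> J \<Longrightarrow> h \<in> polys n \<Longrightarrow> f * h \<in> J" using I_r_closed[of f h] by simp
  show neg: "f \<in> J \<Longrightarrow> - f \<in> J" for f using mult[of f "- 1"] by simp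
  show "f \<in> J \<Longrightarrow> g \<in> J \<Longrightarrow> f - g \<in> J" using add[of f "- g"] neg[of g] by simp
  show "(\<And>i. i \<in> A \<Longrightarrow> F i \<in> J) \<Longrightarrow> sum F A \<in> J"
    by (induction A rule: infinite_finite_induct) (auto simp: 0 add)
qed

lemma ideal_polysI:
  assumes "J \<subseteq> polys n" "0 \<in> J" "\<And>f g. f \<in> J \<Longrightarrow> g \<in> J \<Longrightarrow> f + g \<in> J"
    and mult: "\<And>f h. f \<in> J \<Longrightarrow> h \<in> polys n \<Longrightarrow> h * f \<in> J"
  shows "ideal J (mpoly_ring n)"
proof -
  interpret R: cring "mpoly_ring n :: 'a mpoly ring" by (rule mpoly_ring_cring)
  show ?thesis
  proof (rule idealI)
    show "subgroup J (add_monoid (mpoly_ring n))"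
    proof (rule R.add.subgroupI)
      fix a assume a: "a \<in> J"
      then have "\<ominus>\<^bsub>mpoly_ring n\<^esub> a = - a"
        using assms(1) by (intro R.minus_equality) auto
      then show "\<ominus>\<^bsub>mpoly_ring n\<^esub> a \<in> J"
        using mult[OF a, of "- 1"] by simp
    qed (use assms in auto)
  qed (use assms in \<open>auto simp: mult.commute R.ring_axioms\<close>)
qed

definition graded :: "('k::field) mpoly set \<Rightarrow> bool" where
  "graded J \<longleftrightarrow> (\<forall>f\<in>J. \<forall>r. hcomp r f \<in> J)"

text \<open>The polynomials all of whose components lie in \<open>J\<close> form an ideal, and the
  homogeneous generators belong to it. This turns a hypothesis on generators into one that applies
  to elements.\<close>

lemma homogeneous_ideal_graded:
  assumes "homogeneous_ideal n J"
  shows "graded J"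
proof -
  interpret R: cring "mpoly_ring n :: 'a mpoly ring" by (rule mpoly_ring_cring)
  obtain B where B: "B \<subseteq> polys n" "\<And>f. f \<in> B \<Longrightarrow> \<exists>r. homogeneous r f" "J = genideal (mpoly_ring n) B"
    and J: "ideal J (mpoly_ring n)"
    using assms unfolding homogeneous_ideal_def by blast
  note D = ideal_polysD[OF J]
  let ?K = "{f \<in> polys n. \<forall>r. hcomp r f \<in> J}"
  have "ideal ?K (mpoly_ring n)"
  proof (rule ideal_polysI)
    fix f h :: "'a mpoly"
    assume f: "f \<in> ?K" and h: "h \<in> polys n"
    have "hcomp r (h * f) \<in> J" for r
    proof -
      \<comment> \<open>Multiplication by a single term merely shifts components, so
        \<open>h\<close> is split into its terms.\<close>
      have "h * f = (\<Sum>u\<in>Poly_Mapping.keys h. Poly_Mapping.single u (Poly_Mapping.lookup h u) * f)"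
        by (subst mpoly_sum_single[of h]) (simp add: sum_distrib_right)
      then have "hcomp r (h * f) = (\<Sum>u\<in>Poly_Mapping.keys h.
          Poly_Mapping.single u (Poly_Mapping.lookup h u) * hcomp (r - int (mdeg u)) f)"
        by (simp add: hcomp_sum hcomp_single_mult)
      also have "\<dots> \<in> J"
        using f h by (intro D(8) D(6)) (auto simp: mem_polys)
      finally show ?thesis .
    qed
    then show "h * f \<in> ?K" using f h by auto
  qed (auto simp: hcomp_add D)
  moreover have "B \<subseteq> ?K"
    using B R.genideal_self[OF B(1)] by (force simp: hcomp_homogeneous D(2))
  ultimately have "J \<subseteq> ?K" unfolding B(3) by (rule R.genideal_minimal)
  then show ?thesis by (auto simp: graded_def)
qed

definition ideal_plus :: "nat \<Rightarrow> ('k::field) mpoly set \<Rightarrow> 'k mpoly \<Rightarrow> 'k mpoly set" where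
  "ideal_plus n J z = {g + z * e | g e. g \<in> J \<and> e \<in> polys n}"

lemma ideal_plusI: "g \<in> J \<Longrightarrow> e \<in> polys n \<Longrightarrow> g + z * e \<in> ideal_plus n J z"
  by (auto simp: ideal_plus_def)

lemma ideal_plus_superset: "J \<subseteq> ideal_plus n J z"
  using ideal_plusI[of _ J 0 n z] by auto

lemma mem_ideal_plus: "ideal J (mpoly_ring n) \<Longrightarrow> e \<in> polys n \<Longrightarrow> z * e \<in> ideal_plus n J z"
  using ideal_plusI[of 0 J e n z] by (simp add: ideal_polysD)

lemma ideal_ideal_plus:
  assumes J: "ideal J (mpoly_ring n)" and z: "z \<in> polys n"
  shows "ideal (ideal_plus n J z) (mpoly_ring n)"
proof (rule ideal_polysI)
  note D = ideal_polysD[OF J]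
  show "ideal_plus n J z \<subseteq> polys n" using D(1) z by (auto simp: ideal_plus_def)
  show "0 \<in> ideal_plus n J z" using ideal_plusI[of 0 J 0 n z] D(2) by simp
  fix f assume "f \<in> ideal_plus n J z"
  then obtain a b where f: "f = a + z * b" "a \<in> J" "b \<in> polys n" by (auto simp: ideal_plus_def)
  { fix g assume "g \<in> ideal_plus n J z"
    then obtain c d where g: "g = c + z * d" "c \<in> J" "d \<in> polys n" by (auto simp: ideal_plus_def)
    have "f + g = (a + c) + z * (b + d)" by (simp add: f g algebra_simps)
    with f g D(3) show "f + g \<in> ideal_plus n J z" by (auto simp only: intro!: ideal_plusI) }
  { fix h :: "'a mpoly" assume h: "h \<in> polys n"
    have "h * f = h * a + z * (h * b)" by (simp add: f algebra_simps)
    with f h D(6) show "h * f \<in> ideal_plus n J z" by (auto simp only: intro!: ideal_plusI) }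
qed

lemma genideal_insert:
  assumes A: "A \<subseteq> polys n" and z: "z \<in> polys n"
  shows "genideal (mpoly_ring n) (insert z A) = ideal_plus n (genideal (mpoly_ring n) A) z"
proof -
  interpret R: cring "mpoly_ring n :: 'a mpoly ring" by (rule mpoly_ring_cring)
  let ?G = "genideal (mpoly_ring n) A" and ?H = "genideal (mpoly_ring n) (insert z A)"
  have G: "ideal ?G (mpoly_ring n)" and H: "ideal ?H (mpoly_ring n)"
    using A z by (auto intro!: R.genideal_ideal)
  have "insert z A \<subseteq> ideal_plus n ?G z"
    using mem_ideal_plus[OF G, of 1 z] R.genideal_self[OF A] ideal_plus_superset[of ?G n z] by auto
  then have "?H \<subseteq> ideal_plus n ?G z"
    by (rule R.genideal_minimal[OF ideal_ideal_plus[OF G z]])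
  moreover have "?G \<subseteq> ?H" "z \<in> ?H"
    using R.genideal_self[of "insert z A"] A z by (auto intro!: R.genideal_minimal[OF H])
  then have "ideal_plus n ?G z \<subseteq> ?H"
    using ideal_polysD[OF H] by (auto simp: ideal_plus_def)
  ultimately show ?thesis by blast
qed

text \<open>Taking the component of degree \<open>r\<close> of f = g + x_j e replaces
  \<open>e\<close> by its component of degree \<open>r - 1\<close> and keeps \<open>g\<close> in
  \<open>J\<close>. The lifts in \<open>coboundary_Var_cancel\<close> must be homogeneous in order
  to form a cochain.\<close>

lemma graded_ideal_plus_decomp:
  assumes J: "ideal J (mpoly_ring n)" and gr: "graded J"
    and f: "f \<in> ideal_plus n J (Var j)" and h: "homogeneous r f"
  obtains e where "e \<in> polys n" "homogeneous (r - 1) e" "f - Var j * e \<in> J"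
proof -
  obtain g e where g: "f = g + Var j * e" "g \<in> J" and e: "e \<in> polys n"
    using f by (auto simp: ideal_plus_def)
  have "f = hcomp r f" using h by (simp add: hcomp_homogeneous)
  also have "\<dots> = hcomp r g + Var j * hcomp (r - 1) e" by (simp add: g hcomp_add hcomp_Var_mult)
  finally have "f - Var j * hcomp (r - 1) e = hcomp r g" by simp
  with g gr have "f - Var j * hcomp (r - 1) e \<in> J" by (simp add: graded_def)
  moreover have "hcomp (r - 1) e \<in> polys n" using e by auto
  ultimately show ?thesis using that by simp
qed

lemma graded_ideal_plus:
  assumes gr: "graded J"
  shows "graded (ideal_plus n J (Var j))"
proof -
  have "hcomp r (g + Var j * e) \<in> ideal_plus n J (Var j)" if "g \<in> J" "e \<in> polys n" for g e r
    using that gr by (auto simp: hcomp_add hcomp_Var_mult graded_def intro!: ideal_plusI)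
  then show ?thesis by (auto simp: graded_def ideal_plus_def)
qed


section \<open>Cochains with a common denominator\<close>

abbreviation vprod :: "nat set \<Rightarrow> ('k::field) mpoly" where
  "vprod F \<equiv> (\<Prod>i\<in>F. Var i)"

definition sgn_at :: "nat set \<Rightarrow> nat \<Rightarrow> ('k::field) mpoly" where
  "sgn_at G j = (- 1) ^ card {i \<in> G. i < j}"

text \<open>Read \<open>u F\<close> as the numerator of a fraction over x_F^K. Passing from F = G -
  {j} to G expands that fraction by x_j^K, and the alternating sum is the resulting numerator over
  x_G^K.\<close>

definition delta :: "nat \<Rightarrow> (nat set \<Rightarrow> ('k::field) mpoly) \<Rightarrow> nat set \<Rightarrow> 'k mpoly" where
  "delta K u G = (\<Sum>j\<in>G. sgn_at G j * (Var j ^ K * u (G - {j})))"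

text \<open>Since x_F has degree \<open>p\<close>, this is the condition that the fraction
  \<open>u F\<close> over x_F^K has degree \<open>r\<close>.\<close>

definition cochain :: "nat \<Rightarrow> nat \<Rightarrow> nat \<Rightarrow> int \<Rightarrow> (nat set \<Rightarrow> ('k::field) mpoly) \<Rightarrow> bool" where
  "cochain n p K r u \<longleftrightarrow>
     (\<forall>F\<in>faces n p. u F \<in> polys n \<and> homogeneous (r + int K * int p) (u F))"

lemma sgn_at_sq [simp]: "sgn_at G j * sgn_at G j = 1"
  by (simp add: sgn_at_def flip: power_mult_distrib)

lemma sgn_at_remove_less:
  assumes "finite G" "j \<in> G" "j < l"
  shows "sgn_at (G - {j}) l = - sgn_at G l"
proof -
  have "{i \<in> G. i < l} = insert j {i \<in> G - {j}. i < l}" using assms by auto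
  then have "card {i \<in> G. i < l} = Suc (card {i \<in> G - {j}. i < l})" using assms by simp
  then show ?thesis by (simp add: sgn_at_def)
qed

lemma sgn_at_remove_ge:
  assumes "l \<le> j"
  shows "sgn_at (G - {j}) l = sgn_at G l"
proof -
  have "{i \<in> G - {j}. i < l} = {i \<in> G. i < l}" using assms by auto
  then show ?thesis by (simp add: sgn_at_def)
qed

lemma faces_finite: "F \<in> faces n p \<Longrightarrow> finite F"
  by (auto simp: faces_def intro: finite_subset)

lemma faces_remove: "G \<in> faces n (Suc p) \<Longrightarrow> j \<in> G \<Longrightarrow> G - {j} \<in> faces n p"
  using faces_finite[of G n "Suc p"] by (auto simp: faces_def)

lemma faces_insert: "F \<in> faces n p \<Longrightarrow> j \<notin> F \<Longrightarrow> j \<in> {1..n} \<Longrightarrow> insert j F \<in> faces n (Suc p)"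
  using faces_finite[of F n p] by (auto simp: faces_def)

lemma faces_mem: "F \<in> faces n p \<Longrightarrow> j \<in> F \<Longrightarrow> j \<in> {1..n}"
  by (auto simp: faces_def)

lemma vprod_polys [simp]: "F \<in> faces n p \<Longrightarrow> vprod F \<in> polys n"
  using faces_mem by (intro polys_prod) (metis Var_polys)

lemma homogeneous_vprod: "F \<in> faces n p \<Longrightarrow> homogeneous (int p) (vprod F)"
  using homogeneous_prod[of F Var] faces_finite[of F n p] by (simp add: faces_def)

lemma sgn_at_polys [simp]: "sgn_at G j \<in> polys n"
  unfolding sgn_at_def by (intro polys_power polys_closed)

lemma homogeneous_sgn_at_mult: "homogeneous r f \<Longrightarrow> homogeneous r (sgn_at G j * f)"
  by (cases "even (card {i \<in> G. i < j})") (auto simp: sgn_at_def)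

text \<open>Expanding all fractions from the exponent \<open>K\<close> to \<open>K + a\<close>
  commutes with the differential. This is how families with different denominators are made
  comparable.\<close>

lemma delta_scale:
  assumes "finite G"
  shows "delta (K + a) (\<lambda>F. vprod F ^ a * u F) G = vprod G ^ a * delta K u G"
proof -
  have "Var j ^ (K + a) * (vprod (G - {j}) ^ a * u (G - {j})) = vprod G ^ a * (Var j ^ K * u (G - {j}))"
    if "j \<in> G" for j
    unfolding prod.remove[OF assms that, of Var]
    by (simp add: power_add power_mult_distrib algebra_simps)
  then show ?thesis
    unfolding delta_def sum_distrib_left by (intro sum.cong) (simp_all add: algebra_simps)
qed

lemma delta_add: "delta K (\<lambda>F. u F + v F) = (\<lambda>G. delta K u G + delta K v G)"
  by (simp add: delta_def fun_eq_iff algebra_simps sum.distrib)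

lemma delta_diff: "delta K (\<lambda>F. u F - v F) G = delta K u G - delta K v G"
  by (simp add: delta_def algebra_simps sum_subtractf)

lemma delta_cmult: "delta K (\<lambda>F. c * u F) G = c * delta K u G"
  by (simp add: delta_def sum_distrib_left algebra_simps)

lemma delta_delta:
  assumes G: "finite G"
  shows "delta K (delta K v) G = 0"
proof -
  define T where "T j l = sgn_at G j * (Var j ^ K * (sgn_at (G - {j}) l *
      (Var l ^ K * v (G - {j} - {l}))))" for j l
  \<comment> \<open>Removing \<open>j\<close> and \<open>l\<close> in either order leaves the same
    face, but removing the smaller index first flips the sign belonging to the larger one.\<close>
  have anti: "T j l + T l j = 0" if "j \<in> G" "l \<in> G" "j < l" for j l
  proof -
    have "G - {l} - {j} = G - {j} - {l}" by blast
    then show ?thesis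
      using that by (simp add: T_def algebra_simps G sgn_at_remove_less sgn_at_remove_ge)
  qed
  have "delta K (delta K v) G = (\<Sum>j\<in>G. \<Sum>l\<in>G - {j}. T j l)"
    by (simp add: delta_def T_def sum_distrib_left)
  also have "\<dots> = (\<Sum>j\<in>G. \<Sum>l\<in>G. (if j < l then T j l else 0) + (if l < j then T j l else 0))"
  proof (rule sum.cong[OF refl])
    fix j assume j: "j \<in> G"
    have "(\<Sum>l\<in>G. (if j < l then T j l else 0) + (if l < j then T j l else 0)) =
        (\<Sum>l\<in>G - {j}. (if j < l then T j l else 0) + (if l < j then T j l else 0))"
      using G j by (simp add: sum.remove)
    also have "\<dots> = (\<Sum>l\<in>G - {j}. T j l)"
      by (intro sum.cong) (auto simp: not_less_iff_gr_or_eq)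
    finally show "(\<Sum>l\<in>G - {j}. T j l) =
        (\<Sum>l\<in>G. (if j < l then T j l else 0) + (if l < j then T j l else 0))" ..
  qed
  also have "\<dots> = (\<Sum>j\<in>G. \<Sum>l\<in>G. if j < l then T j l else 0) +
      (\<Sum>j\<in>G. \<Sum>l\<in>G. if l < j then T j l else 0)"
    by (simp add: sum.distrib)
  also have "(\<Sum>j\<in>G. \<Sum>l\<in>G. if l < j then T j l else 0) =
      (\<Sum>j\<in>G. \<Sum>l\<in>G. if j < l then T l j else 0)"
    by (rule sum.swap)
  also have "(\<Sum>j\<in>G. \<Sum>l\<in>G. if j < l then T j l else 0) + \<dots> =
      (\<Sum>j\<in>G. \<Sum>l\<in>G. if j < l then T j l + T l j else 0)"
    by (simp flip: sum.distrib) (intro sum.cong, auto)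
  also have "\<dots> = 0" using anti by (intro sum.neutral ballI) auto
  finally show ?thesis .
qed

lemma delta_cochain:
  assumes "cochain n p K r v"
  shows "cochain n (Suc p) K r (delta K v)"
  unfolding cochain_def
proof (intro ballI conjI)
  fix G assume G: "G \<in> faces n (Suc p)"
  have F: "v (G - {j}) \<in> polys n" "homogeneous (r + int K * int p) (v (G - {j}))"
      "(Var j :: 'a mpoly) \<in> polys n" if "j \<in> G" for j
    using assms faces_remove[OF G that] Var_polys[OF faces_mem[OF G that]]
    by (simp_all add: cochain_def)
  then show "delta K v G \<in> polys n"
    unfolding delta_def by (intro polys_sum polys_closed sgn_at_polys polys_power) auto
  have "homogeneous (r + int K * int (Suc p)) (Var j ^ K * v (G - {j}))" if "j \<in> G" for j
    using homogeneous_mult[OF homogeneous_power[OF homogeneous_Var, of K j] F(2)[OF that]]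
    by (simp add: algebra_simps)
  then show "homogeneous (r + int K * int (Suc p)) (delta K v G)"
    unfolding delta_def by (intro homogeneous_sum homogeneous_sgn_at_mult) auto
qed

lemma cochain_scale:
  assumes "cochain n p K r u"
  shows "cochain n p (K + a) r (\<lambda>F. vprod F ^ a * u F)"
  unfolding cochain_def
proof (intro ballI conjI)
  fix F assume F: "F \<in> faces n p"
  then show "vprod F ^ a * u F \<in> polys n"
    using assms by (auto simp: cochain_def)
  have "homogeneous (int a * int p + (r + int K * int p)) (vprod F ^ a * u F)"
    using assms F by (intro homogeneous_mult homogeneous_power homogeneous_vprod) (auto simp: cochain_def)
  then show "homogeneous (r + int (K + a) * int p) (vprod F ^ a * u F)"
    by (simp add: algebra_simps)
qed

lemma cochain_diff: "cochain n p K r u \<Longrightarrow> cochain n p K r v \<Longrightarrow> cochain n p K r (\<lambda>F. u F - v F)"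
  by (auto simp: cochain_def)

lemma cochain_Var_mult:
  assumes "cochain n p K r u" "j \<in> {1..n}"
  shows "cochain n p K (r + int m) (\<lambda>F. Var j ^ m * u F)"
  unfolding cochain_def
proof (intro ballI conjI)
  fix F assume F: "F \<in> faces n p"
  then show "Var j ^ m * u F \<in> polys n"
    using assms by (simp add: cochain_def)
  have "homogeneous (int m * 1 + (r + int K * int p)) (Var j ^ m * u F)"
    using assms F by (intro homogeneous_mult homogeneous_power) (auto simp: cochain_def)
  then show "homogeneous (r + int m + int K * int p) (Var j ^ m * u F)"
    by (simp add: algebra_simps)
qed

lemma delta_mem:
  assumes J: "ideal J (mpoly_ring n)" and u: "\<And>F. F \<in> faces n p \<Longrightarrow> u F \<in> J"
    and G: "G \<in> faces n (Suc p)"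
  shows "delta K u G \<in> J"
  unfolding delta_def
proof (intro ideal_polysD(8)[OF J] ideal_polysD(6)[OF J])
  fix j assume "j \<in> G"
  with G show "u (G - {j}) \<in> J" "Var j ^ K \<in> polys n"
    using faces_mem faces_remove by (auto intro!: u polys_power Var_polys)
qed simp

text \<open>The contracting homotopy of the Cech complex with x_j inverted, written on numerators.
  If \<open>u\<close> is a cocycle modulo an ideal, the right-hand side lies in that ideal, so x_j^K
  u is a coboundary.\<close>

lemma delta_homotopy:
  fixes u :: "nat set \<Rightarrow> ('k::field) mpoly"
    and j :: nat
  assumes G: "finite G"
  defines "b \<equiv> \<lambda>F. if j \<in> F then 0 else sgn_at F j * u (insert j F)"
  shows "Var j ^ K * u G - delta K b G = (if j \<in> G then 0 else sgn_at G j * delta K u (insert j G))"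
proof (cases "j \<in> G")
  case True
  \<comment> \<open>\<open>b\<close> vanishes on every face containing \<open>j\<close>, so only the
    summand that removes \<open>j\<close> survives.\<close>
  have "delta K b G = (\<Sum>l\<in>G. if l = j then sgn_at G j * (Var j ^ K * b (G - {j})) else 0)"
    unfolding delta_def using True by (intro sum.cong) (auto simp: b_def)
  also have "\<dots> = sgn_at G j * (Var j ^ K * b (G - {j}))"
    using G True by simp
  also have "\<dots> = (sgn_at G j * sgn_at G j) * (Var j ^ K * u G)"
    using True by (simp add: b_def insert_absorb algebra_simps sgn_at_remove_ge del: sgn_at_sq)
  finally show ?thesis using True by simp
next
  case False
  let ?G = "insert j G"
  have sgn: "sgn_at G j * sgn_at ?G l = - (sgn_at G l * sgn_at (G - {l}) j :: 'k mpoly)" if l: "l \<in> G" for l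
  proof (cases "j < l")
    case True
    then show ?thesis
      using sgn_at_remove_less[of ?G j l, where 'a = 'k] G False by (simp add: sgn_at_remove_ge)
  next
    case nless: False
    with l False have "l < j" by (metis linorder_neqE_nat)
    then show ?thesis
      using sgn_at_remove_ge[of l j ?G, where 'a = 'k] G False l
      by (simp add: sgn_at_remove_less mult.commute)
  qed
  \<comment> \<open>In the differential at G with \<open>j\<close> added, the summand omitting
    \<open>j\<close> is x_j^K u G up to sign; the others reassemble to minus the differential of
    \<open>b\<close>.\<close>
  have "sgn_at G j * delta K u ?G = sgn_at G j * (sgn_at ?G j * (Var j ^ K * u G)) +
      (\<Sum>l\<in>G. (sgn_at G j * sgn_at ?G l) * (Var l ^ K * u (?G - {l})))"
    using G False by (simp add: delta_def algebra_simps sum_distrib_left)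
  also have "(\<Sum>l\<in>G. (sgn_at G j * sgn_at ?G l) * (Var l ^ K * u (?G - {l}))) =
      (\<Sum>l\<in>G. - (sgn_at G l * (Var l ^ K * b (G - {l}))))"
  proof (rule sum.cong[OF refl])
    fix l assume l: "l \<in> G"
    have "insert j (G - {l}) = ?G - {l}" using False l by auto
    then show "(sgn_at G j * sgn_at ?G l) * (Var l ^ K * u (?G - {l})) =
        - (sgn_at G l * (Var l ^ K * b (G - {l})))"
      unfolding sgn[OF l] using False by (simp add: b_def algebra_simps)
  qed
  also have "\<dots> = - delta K b G"
    by (simp add: delta_def sum_negf)
  also have "sgn_at G j * (sgn_at ?G j * (Var j ^ K * u G)) = Var j ^ K * u G"
    using sgn_at_remove_ge[of j j ?G, where 'a = 'k] False by (simp flip: mult.assoc)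
  finally show ?thesis using False by simp
qed


section \<open>Vanishing of the cohomology in high degrees\<close>

text \<open>The exponent \<open>a\<close> covers both the denominators of a preimage and the power
  of x_F needed to see an equality in the localisation. For \<open>p = 0\<close> the differential
  over the empty face is an empty sum, and the condition becomes \<open>u {}\<close> in
  \<open>J\<close>.\<close>

definition coboundary :: "nat \<Rightarrow> ('k::field) mpoly set \<Rightarrow> nat \<Rightarrow> nat \<Rightarrow> int \<Rightarrow> (nat set \<Rightarrow> 'k mpoly) \<Rightarrow> bool"
  where
  "coboundary n J p K r u \<longleftrightarrow>
     (\<exists>a v. (\<forall>q. p = Suc q \<longrightarrow> cochain n q (K + a) r v) \<and>
            (\<forall>F\<in>faces n p. vprod F ^ a * u F - delta (K + a) v F \<in> J))"

text \<open>The cocycle condition is imposed in \<open>J\<close> itself, without a further power of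
  x_G; \<open>cocycle_coboundary\<close> brings cocycles of the Cech complex into this form by
  enlarging \<open>K\<close>.\<close>

definition exact_at :: "nat \<Rightarrow> ('k::field) mpoly set \<Rightarrow> nat \<Rightarrow> int \<Rightarrow> bool" where
  "exact_at n J p r \<longleftrightarrow>
     (\<forall>K u. cochain n p K r u \<longrightarrow> (\<forall>G\<in>faces n (Suc p). delta K u G \<in> J) \<longrightarrow>
            coboundary n J p K r u)"

definition regular_above :: "nat \<Rightarrow> ('k::field) mpoly set \<Rightarrow> nat \<Rightarrow> int \<Rightarrow> bool" where
  "regular_above n J j B \<longleftrightarrow>
     (\<forall>s f. s > B \<longrightarrow> f \<in> polys n \<longrightarrow> homogeneous s f \<longrightarrow> Var j * f \<in> J \<longrightarrow> f \<in> J)"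

lemma regular_above_power:
  assumes "regular_above n J j B" "j \<in> {1..n}" "homogeneous s f" "f \<in> polys n" "s > B"
    and "Var j ^ m * f \<in> J"
  shows "f \<in> J"
  using assms(6)
proof (induction m)
  case (Suc m)
  have "homogeneous (int m * 1 + s) (Var j ^ m * f)"
    using assms by (intro homogeneous_mult homogeneous_power) auto
  moreover have "Var j * (Var j ^ m * f) \<in> J" using Suc.prems by (simp add: algebra_simps)
  moreover have "Var j ^ m * f \<in> polys n" using assms by simp
  ultimately have "Var j ^ m * f \<in> J"
    using assms(1,5) unfolding regular_above_def by (smt (verit) of_nat_0_le_iff)
  then show ?case by (rule Suc.IH)
qed simp

text \<open>The empty face has denominator 1, so the degree of \<open>u {}\<close> cannot be raised:
  x_j^K has to be cancelled in degree \<open>r\<close>, and this is where \<open>r > B\<close> is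
  used.\<close>

lemma exact_at_0:
  assumes J: "ideal J (mpoly_ring n)" and j: "j \<in> {1..n}" and reg: "regular_above n J j B" and r: "r > B"
  shows "exact_at n J 0 r"
  unfolding exact_at_def
proof (intro allI impI)
  fix K u
  assume u: "cochain n 0 K r u" and d: "\<forall>G\<in>faces n (Suc 0). delta K u G \<in> J"
  have e: "faces n 0 = {{}}" by (auto simp: faces_def dest: finite_subset)
  have "delta K u {j} \<in> J" using d j by (auto simp: faces_def)
  then have "Var j ^ K * u {} \<in> J" by (simp add: delta_def sgn_at_def cong: conj_cong)
  moreover have "homogeneous r (u {})" "u {} \<in> polys n" using u e by (auto simp: cochain_def)
  ultimately have "u {} \<in> J" using regular_above_power[OF reg j _ _ r] by blast
  then show "coboundary n J 0 K r u"
    unfolding coboundary_def by (intro exI[of _ 0]) (simp add: e delta_def)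
qed

text \<open>
  The long exact sequence of multiplication by \<open>x\<^sub>j\<close>, spelled out on representatives: if
  \<open>x\<^sub>j u = d v\<close> then \<open>v\<close> is a cocycle modulo \<open>x\<^sub>j\<close>, so \<open>v = d w + x\<^sub>j e\<close> and
  \<open>x\<^sub>j (u - d e) = 0\<close>.
\<close>

lemma coboundary_Var_cancel:
  assumes J: "ideal J (mpoly_ring n)" and gr: "graded J" and j: "j \<in> {1..n}"
    and reg: "regular_above n J j B"
    and ex: "exact_at n (ideal_plus n J (Var j)) p (r + 1)"
    and u: "cochain n (Suc p) K r u"
    and cob: "coboundary n J (Suc p) K (r + 1) (\<lambda>F. Var j * u F)"
  shows "coboundary n J (Suc p) K r u"
proof -
  let ?J = "ideal_plus n J (Var j)"
  note D = ideal_polysD[OF J]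
  note D' = ideal_polysD[OF ideal_ideal_plus[OF J Var_polys[OF j]]]
  obtain a v where v: "cochain n p (K + a) (r + 1) v"
    and uv: "\<And>F. F \<in> faces n (Suc p) \<Longrightarrow> vprod F ^ a * (Var j * u F) - delta (K + a) v F \<in> J"
    using cob unfolding coboundary_def by blast
  let ?L = "K + a"
  have "delta ?L v F \<in> ?J" if F: "F \<in> faces n (Suc p)" for F
  proof -
    have "Var j * (vprod F ^ a * u F) \<in> ?J"
      using u F by (intro mem_ideal_plus[OF J]) (simp add: cochain_def)
    moreover have "vprod F ^ a * (Var j * u F) - delta ?L v F \<in> ?J"
      using uv[OF F] ideal_plus_superset by blast
    ultimately have "Var j * (vprod F ^ a * u F) - (vprod F ^ a * (Var j * u F) - delta ?L v F) \<in> ?J"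
      by (rule D'(5))
    then show ?thesis by (simp add: algebra_simps)
  qed
  with ex v have "coboundary n ?J p ?L (r + 1) v" by (simp add: exact_at_def)
  then obtain b w where w: "\<And>q. p = Suc q \<Longrightarrow> cochain n q (?L + b) (r + 1) w"
    and vw: "\<And>F. F \<in> faces n p \<Longrightarrow> vprod F ^ b * v F - delta (?L + b) w F \<in> ?J"
    unfolding coboundary_def by blast
  let ?M = "?L + b"
  define v' u' where "v' = (\<lambda>F. vprod F ^ b * v F)" and "u' = (\<lambda>F. vprod F ^ (a + b) * u F)"
  have v': "cochain n p ?M (r + 1) v'" unfolding v'_def by (rule cochain_scale[OF v])
  have u': "cochain n (Suc p) ?M r u'"
    unfolding u'_def using cochain_scale[OF u, of "a + b"] by (simp add: algebra_simps)
  have uv': "Var j * u' F - delta ?M v' F \<in> J" if F: "F \<in> faces n (Suc p)" for F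
  proof -
    have "vprod F ^ b * (vprod F ^ a * (Var j * u F) - delta ?L v F) \<in> J"
      using F by (intro D(6) uv) auto
    moreover have "delta ?M v' F = vprod F ^ b * delta ?L v F"
      unfolding v'_def using faces_finite[OF F] by (rule delta_scale)
    ultimately show ?thesis by (simp add: u'_def power_add algebra_simps)
  qed
  have "\<exists>e. e \<in> polys n \<and> homogeneous (r + int ?M * int p) e \<and> v' F - delta ?M w F - Var j * e \<in> J"
    if F: "F \<in> faces n p" for F
  proof -
    have "homogeneous (r + 1 + int ?M * int p) (delta ?M w F)"
    \<comment> \<open>For \<open>p = 0\<close> no degree of \<open>w\<close> is known, but its
      differential over the empty face is 0.\<close>
    proof (cases p)
      case 0
      then have "F = {}" using F by (auto simp: faces_def dest: finite_subset)
      then show ?thesis by (simp add: delta_def)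
    next
      case (Suc q)
      then show ?thesis using delta_cochain[OF w[OF Suc]] F by (simp add: cochain_def)
    qed
    with v' F have "homogeneous (r + 1 + int ?M * int p) (v' F - delta ?M w F)"
      by (auto simp: cochain_def)
    moreover have "v' F - delta ?M w F \<in> ?J" using vw[OF F] by (simp add: v'_def)
    ultimately obtain e where "e \<in> polys n" "homogeneous (r + 1 + int ?M * int p - 1) e"
        "v' F - delta ?M w F - Var j * e \<in> J"
      using graded_ideal_plus_decomp[OF J gr] by metis
    then show ?thesis by (auto simp: algebra_simps)
  qed
  then obtain e where e: "\<And>F. F \<in> faces n p \<Longrightarrow> e F \<in> polys n \<and> homogeneous (r + int ?M * int p) (e F) \<and>
      v' F - delta ?M w F - Var j * e F \<in> J"
    by metis
  then have ce: "cochain n p ?M r e" by (simp add: cochain_def)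
  \<comment> \<open>On the nonempty faces below x_F has degree at least 1, so the factor x_F^c lifts
    the numerators above degree \<open>B\<close> for any \<open>r\<close>, and there x_j may be
    cancelled.\<close>
  define c where "c = nat (B + 1 - r)"
  have main: "vprod F ^ c * (u' F - delta ?M e F) \<in> J" if F: "F \<in> faces n (Suc p)" for F
  proof -
    have "delta ?M (\<lambda>F. v' F - delta ?M w F - Var j * e F) F \<in> J"
      using e F by (intro delta_mem[OF J]) auto
    then have "delta ?M v' F - Var j * delta ?M e F \<in> J"
      using delta_delta[OF faces_finite[OF F], of ?M w] by (simp add: delta_diff delta_cmult)
    from D(3)[OF uv'[OF F] this] have "Var j * (u' F - delta ?M e F) \<in> J"
      by (simp add: algebra_simps)
    from D(6)[OF this] have "vprod F ^ c * (Var j * (u' F - delta ?M e F)) \<in> J"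
      using F by auto
    then have z: "Var j * (vprod F ^ c * (u' F - delta ?M e F)) \<in> J"
      by (simp add: mult.left_commute)
    have "cochain n (Suc p) (?M + c) r (\<lambda>F. vprod F ^ c * (u' F - delta ?M e F))"
      by (intro cochain_scale cochain_diff u' delta_cochain ce)
    then have "vprod F ^ c * (u' F - delta ?M e F) \<in> polys n"
      and "homogeneous (r + int (?M + c) * int (Suc p)) (vprod F ^ c * (u' F - delta ?M e F))"
      using F by (auto simp: cochain_def)
    moreover have "r + int (?M + c) * int (Suc p) > B"
    proof -
      have "int c * 1 \<le> int (?M + c) * int (Suc p)"
        by (intro mult_mono) auto
      moreover have "r + int c > B" by (simp add: c_def)
      ultimately show ?thesis by linarith
    qed
    ultimately show ?thesis using reg z unfolding regular_above_def by blast
  qed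
  show ?thesis
    unfolding coboundary_def
  proof (intro exI conjI allI impI ballI)
    \<comment> \<open>The exponent collects \<open>a\<close> from the given preimage of x_j u,
      \<open>b\<close> from exactness modulo x_j, and \<open>c\<close> from the shift beyond
      \<open>B\<close>.\<close>
    show "cochain n q (K + (a + b + c)) r (\<lambda>F. vprod F ^ c * e F)" if "Suc p = Suc q" for q
      using cochain_scale[OF ce, of c] that by (simp add: algebra_simps)
    show "vprod F ^ (a + b + c) * u F - delta (K + (a + b + c)) (\<lambda>F. vprod F ^ c * e F) F \<in> J"
      if F: "F \<in> faces n (Suc p)" for F
      using main[OF F] delta_scale[OF faces_finite[OF F], of ?M c e]
      by (simp add: u'_def power_add algebra_simps)
  qed
qed

text \<open>Adjoining x_j trades one cohomological degree for one internal degree, so the condition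
  on their sum is passed on unchanged. \<open>delta_homotopy\<close> supplies the power of x_j from
  which the cancellation starts.\<close>

lemma exact_at_Suc:
  assumes J: "ideal J (mpoly_ring n)" and gr: "graded J" and j: "j \<in> {1..n}"
    and reg: "regular_above n J j B"
    and ex: "\<And>s. s + int p > B \<Longrightarrow> exact_at n (ideal_plus n J (Var j)) p s"
    and r: "r + int (Suc p) > B"
  shows "exact_at n J (Suc p) r"
  unfolding exact_at_def
proof (intro allI impI)
  fix K u
  assume u: "cochain n (Suc p) K r u" and d: "\<forall>G\<in>faces n (Suc (Suc p)). delta K u G \<in> J"
  \<comment> \<open>The factors x_j are cancelled one at a time. The intermediate families have
    larger internal degree than \<open>u'\<close>, so the bound persists.\<close>
  have reduce: "coboundary n J (Suc p) K r' u'"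
    if "cochain n (Suc p) K r' u'" "r' + int (Suc p) > B"
      "coboundary n J (Suc p) K (r' + int m) (\<lambda>F. Var j ^ m * u' F)" for m r' u'
    using that
  proof (induction m arbitrary: r' u')
    case (Suc m)
    have "cochain n (Suc p) K (r' + 1) (\<lambda>F. Var j * u' F)"
      using cochain_Var_mult[OF Suc.prems(1) j, of 1] by simp
    moreover have "(\<lambda>F. Var j ^ m * (Var j * u' F)) = (\<lambda>F. Var j ^ Suc m * u' F)"
      by (simp add: algebra_simps)
    then have "coboundary n J (Suc p) K (r' + 1 + int m) (\<lambda>F. Var j ^ m * (Var j * u' F))"
      using Suc.prems(3) by (simp only: of_nat_Suc add.assoc add.commute[of 1])
    ultimately have "coboundary n J (Suc p) K (r' + 1) (\<lambda>F. Var j * u' F)"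
      using Suc.IH[of "r' + 1" "\<lambda>F. Var j * u' F"] Suc.prems(2) by linarith
    moreover have "exact_at n (ideal_plus n J (Var j)) p (r' + 1)"
      using Suc.prems(2) by (intro ex) simp
    ultimately show ?case
      using coboundary_Var_cancel[OF J gr j reg _ Suc.prems(1)] by blast
  qed simp
  define b where "b = (\<lambda>F. if j \<in> F then 0 else sgn_at F j * u (insert j F))"
  have "coboundary n J (Suc p) K (r + int K) (\<lambda>F. Var j ^ K * u F)"
    unfolding coboundary_def
  proof (intro exI[of _ 0] exI[of _ b] conjI allI impI ballI)
    fix q assume q: "Suc p = Suc q"
    show "cochain n q (K + 0) (r + int K) b"
      unfolding cochain_def
    proof (intro ballI conjI)
      fix F assume F: "F \<in> faces n q"
      have "u (insert j F) \<in> polys n" "homogeneous (r + int K * int (Suc p)) (u (insert j F))" if "j \<notin> F"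
        using u q faces_insert[OF F that j] by (auto simp: cochain_def)
      with q show "b F \<in> polys n" "homogeneous (r + int K + int (K + 0) * int q) (b F)"
        by (auto simp: b_def algebra_simps intro!: homogeneous_sgn_at_mult polys_closed)
    qed
  next
    fix F assume F: "F \<in> faces n (Suc p)"
    have "Var j ^ K * u F - delta K b F \<in> J"
      unfolding b_def delta_homotopy[OF faces_finite[OF F]]
      using d faces_insert[OF F _ j] ideal_polysD(2,6)[OF J] by auto
    then show "vprod F ^ 0 * (Var j ^ K * u F) - delta (K + 0) b F \<in> J" by simp
  qed
  with reduce[OF u r, of K] show "coboundary n J (Suc p) K r u" by blast
qed

text \<open>The induction raises \<open>i\<close> by one whenever it lowers \<open>p\<close> by one.
  Exactness for \<open>Q i\<close> in degree \<open>p\<close> thus calls on the variables with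
  indices \<open>x i\<close>, ..., \<open>x (i + p)\<close>, which is why t + 1 filter-regular
  elements control the cohomology up to degree t.\<close>

proposition exact_at_of_regular_above:
  assumes "\<And>i. ideal (Q i) (mpoly_ring n)" "\<And>i. graded (Q i)"
    and "\<And>i. i \<le> t \<Longrightarrow> x i \<in> {1..n}" "\<And>i. i \<le> t \<Longrightarrow> Q (Suc i) = ideal_plus n (Q i) (Var (x i))"
    and "\<And>i. i \<le> t \<Longrightarrow> regular_above n (Q i) (x i) B"
    and "i + p \<le> t" "r + int p > B"
  shows "exact_at n (Q i) p r"
  using assms(6,7)
proof (induction p arbitrary: i r)
  case 0
  then have "i \<le> t" "r > B" by simp_all
  then show ?case using assms by (intro exact_at_0[of "Q i" n "x i" B]) simp_all
next
  case (Suc p)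
  have "exact_at n (ideal_plus n (Q i) (Var (x i))) p s" if "s + int p > B" for s
    using Suc.IH[of "Suc i" s] Suc.prems that assms(4)[of i] by simp
  then show ?case using exact_at_Suc assms(1,2,3,5) Suc.prems
    by (metis add_leD1)
qed


section \<open>Leading monomials\<close>

lemma revlex_irrefl [simp]: "\<not> revlex_less u u"
  by (simp add: revlex_less_def)

lemma revlex_trans:
  assumes "revlex_less u v" "revlex_less v w"
  shows "revlex_less u w"
proof (cases "mdeg u < mdeg v \<or> mdeg v < mdeg w")
  case True
  then show ?thesis using assms by (auto simp: revlex_less_def)
next
  case False
  then have deg: "mdeg u = mdeg v" "mdeg v = mdeg w"
    using assms by (auto simp: revlex_less_def)
  obtain j where j: "Poly_Mapping.lookup v j < Poly_Mapping.lookup u j"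
      "\<And>i. i > j \<Longrightarrow> Poly_Mapping.lookup u i = Poly_Mapping.lookup v i"
    using assms(1) deg by (auto simp: revlex_less_def)
  obtain k where k: "Poly_Mapping.lookup w k < Poly_Mapping.lookup v k"
      "\<And>i. i > k \<Longrightarrow> Poly_Mapping.lookup v i = Poly_Mapping.lookup w i"
    using assms(2) deg by (auto simp: revlex_less_def)
  have "Poly_Mapping.lookup w (max j k) < Poly_Mapping.lookup u (max j k)"
    using j k by (cases j k rule: linorder_cases) (auto simp: max_def)
  then show ?thesis
    using deg j(2) k(2) by (auto simp: revlex_less_def intro!: exI[of _ "max j k"])
qed

lemma last_difference:
  assumes "(u :: mon) \<noteq> v"
  obtains j where "Poly_Mapping.lookup u j \<noteq> Poly_Mapping.lookup v j"
    "\<And>i. i > j \<Longrightarrow> Poly_Mapping.lookup u i = Poly_Mapping.lookup v i"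
proof -
  let ?D = "{i. Poly_Mapping.lookup u i \<noteq> Poly_Mapping.lookup v i}"
  have "?D \<subseteq> Poly_Mapping.keys u \<union> Poly_Mapping.keys v" by (auto simp: in_keys_iff)
  then have fin: "finite ?D" by (rule finite_subset) simp
  have "?D \<noteq> {}" using assms poly_mapping_eqI[of u v] by blast
  with fin have "Max ?D \<in> ?D" by (rule Max_in)
  moreover have "Poly_Mapping.lookup u i = Poly_Mapping.lookup v i" if "i > Max ?D" for i
    using Max_ge[OF fin, of i] that by fastforce
  ultimately show ?thesis using that by blast
qed

lemma revlex_total:
  assumes "u \<noteq> v"
  shows "revlex_less u v \<or> revlex_less v u"
proof -
  obtain j where "Poly_Mapping.lookup u j \<noteq> Poly_Mapping.lookup v j"
      "\<And>i. i > j \<Longrightarrow> Poly_Mapping.lookup u i = Poly_Mapping.lookup v i"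
    using last_difference[OF assms] by blast
  then show ?thesis unfolding revlex_less_def by (metis linorder_neqE_nat)
qed

lemma revlex_add: "revlex_less u v \<Longrightarrow> revlex_less (w + u) (w + v)"
  by (auto simp: revlex_less_def lookup_add)

lemma finite_mons_mdeg_le: "finite {u \<in> mons n. mdeg u \<le> d}"
proof (rule finite_imageD)
  show "inj_on Poly_Mapping.lookup {u \<in> mons n. mdeg u \<le> d}"
    by (intro inj_onI poly_mapping_eqI) simp
  have "Poly_Mapping.lookup u i \<le> mdeg u" for u i
    unfolding mdeg_def by (cases "i \<in> Poly_Mapping.keys u") (auto simp: in_keys_iff intro: member_le_sum)
  then have "Poly_Mapping.lookup u i \<le> d" if "mdeg u \<le> d" for u i
    using that le_trans by blast
  moreover have "Poly_Mapping.lookup u i = 0" if "u \<in> mons n" "i \<notin> {1..n}" for u i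
    using that not_in_keys_iff_lookup_eq_zero[of i u] unfolding mons_def by blast
  ultimately have "Poly_Mapping.lookup ` {u \<in> mons n. mdeg u \<le> d} \<subseteq>
      {f. \<forall>i. (i \<in> {1..n} \<longrightarrow> f i \<in> {..d}) \<and> (i \<notin> {1..n} \<longrightarrow> f i = 0)}"
    by (intro image_subsetI CollectI allI conjI impI) auto
  then show "finite (Poly_Mapping.lookup ` {u \<in> mons n. mdeg u \<le> d})"
    by (rule finite_subset) (intro finite_set_of_finite_funs, auto)
qed

text \<open>A relational form of \<open>in_mon\<close>: the definite description there is
  informative only if a leading monomial exists, while \<open>lead\<close> carries its existence
  along.\<close>

definition lead :: "('k::field) mpoly \<Rightarrow> mon \<Rightarrow> bool" where
  "lead f u \<longleftrightarrow> u \<in> Poly_Mapping.keys f \<and> (\<forall>v\<in>Poly_Mapping.keys f. v \<noteq> u \<longrightarrow> revlex_less v u)"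

lemma lead_in_mon: "lead f u \<Longrightarrow> in_mon f = u"
  unfolding in_mon_def lead_def by (rule the_equality) (auto, metis revlex_irrefl revlex_trans)

lemma lead_exists:
  assumes "f \<noteq> 0"
  shows "\<exists>u. lead f u"
proof -
  have "\<exists>u\<in>A. \<forall>v\<in>A. v \<noteq> u \<longrightarrow> revlex_less v u" if "finite A" "A \<noteq> {}" for A
    using that
  proof (induction A rule: finite_ne_induct)
    case (insert x A)
    then obtain u where u: "u \<in> A" "\<forall>v\<in>A. v \<noteq> u \<longrightarrow> revlex_less v u" by blast
    show ?case
    proof (cases "revlex_less x u")
      case True
      with u show ?thesis by blast
    next
      case False
      then have "revlex_less u x" using u(1) insert.hyps revlex_total[of x u] by blast
      with u show ?thesis by (metis insert_iff revlex_trans)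
    qed
  qed simp
  moreover have "Poly_Mapping.keys f \<noteq> {}" using assms poly_mapping_eqI[of f 0] by (auto simp: in_keys_iff)
  ultimately show ?thesis unfolding lead_def by (metis finite_keys)
qed

lemma lead_nonzero: "lead f u \<Longrightarrow> f \<noteq> 0"
  by (auto simp: lead_def)

lemma lead_mons: "lead f u \<Longrightarrow> f \<in> polys n \<Longrightarrow> u \<in> mons n"
  by (auto simp: lead_def mem_polys)

lemma lead_mdeg: "lead f u \<Longrightarrow> homogeneous r f \<Longrightarrow> int (mdeg u) = r"
  by (auto simp: lead_def homogeneous_def)

lemma lead_single_mult: "lead f u \<Longrightarrow> c \<noteq> 0 \<Longrightarrow> lead (Poly_Mapping.single w c * f) (w + u)"
  by (auto simp: lead_def keys_single_mult intro: revlex_add)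

lemma lead_hcomp: "lead f u \<Longrightarrow> lead (hcomp (int (mdeg u)) f) u"
  by (auto simp: lead_def keys_hcomp)

lemma lead_cancel:
  assumes f: "lead f u" and g: "lead g u"
  defines "h \<equiv> f - Poly_Mapping.single 0 (Poly_Mapping.lookup f u / Poly_Mapping.lookup g u) * g"
  assumes v: "v \<in> Poly_Mapping.keys h"
  shows "revlex_less v u"
proof -
  have lh: "Poly_Mapping.lookup h w = Poly_Mapping.lookup f w -
      Poly_Mapping.lookup f u / Poly_Mapping.lookup g u * Poly_Mapping.lookup g w" for w
    by (simp add: h_def lookup_minus lookup_single_mult mdvd_def)
  have "Poly_Mapping.lookup g u \<noteq> 0" using g by (simp add: lead_def in_keys_iff)
  then have "v \<noteq> u" using v by (auto simp: in_keys_iff lh)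
  moreover have "v \<in> Poly_Mapping.keys f \<or> v \<in> Poly_Mapping.keys g"
    using v by (auto simp: in_keys_iff lh)
  ultimately show ?thesis using f g by (auto simp: lead_def)
qed

text \<open>The order compares degrees first, so only finitely many monomials of S lie below a given
  one; their number is the measure that gets minimised.\<close>

lemma exists_minimal_lead:
  assumes A: "A \<subseteq> polys n" "A \<noteq> {}" "0 \<notin> A"
  obtains f u where "f \<in> A" "lead f u" "\<And>g v. g \<in> A \<Longrightarrow> lead g v \<Longrightarrow> \<not> revlex_less v u"
proof -
  let ?below = "\<lambda>u. {w \<in> mons n. revlex_less w u}"
  obtain f where f: "f \<in> A" "\<And>g. g \<in> A \<Longrightarrow> card (?below (in_mon f)) \<le> card (?below (in_mon g))"
    using ex_has_least_nat[of "\<lambda>f. f \<in> A" _ "\<lambda>f. card (?below (in_mon f))"] A(2) by blast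
  obtain u where u: "lead f u" using lead_exists f(1) A(3) by metis
  have "\<not> revlex_less v u" if g: "g \<in> A" "lead g v" for g v
  proof
    assume less: "revlex_less v u"
    have "v \<in> mons n" using g A(1) lead_mons by blast
    with less have "?below v \<subseteq> ?below u" "v \<in> ?below u - ?below v"
      by (auto dest: revlex_trans)
    then have "?below v \<subset> ?below u" by blast
    moreover have "finite (?below u)"
      by (rule finite_subset[OF _ finite_mons_mdeg_le[of n "mdeg u"]]) (auto simp: revlex_less_def)
    ultimately have "card (?below v) < card (?below u)" by (simp add: psubset_card_mono)
    then show False using f(2)[OF g(1)] u g(2) by (simp add: lead_in_mon)
  qed
  with f(1) u that show ?thesis by blast
qed

text \<open>Take a member of f + W with minimal leading monomial: an element of \<open>W\<close>
  with the same leading monomial could be scaled and subtracted, giving a smaller one. The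
  formulation for subspaces covers both an ideal and a single graded piece of an ideal.\<close>

lemma reduced_lead:
  assumes W: "W \<subseteq> polys n" and diff: "\<And>p q. p \<in> W \<Longrightarrow> q \<in> W \<Longrightarrow> p - q \<in> W"
    and scale: "\<And>p c. p \<in> W \<Longrightarrow> Poly_Mapping.single 0 c * p \<in> W"
    and f: "f \<in> polys n" "f \<notin> W" and 0: "0 \<in> W"
  obtains g u where "g \<in> polys n" "g - f \<in> W" "lead g u" "\<And>q. q \<in> W \<Longrightarrow> \<not> lead q u"
proof -
  let ?A = "{g \<in> polys n. g - f \<in> W}"
  have "f \<in> ?A" using f 0 by simp
  moreover have "0 \<notin> ?A" using diff[OF 0, of "0 - f"] f(2) by auto
  ultimately obtain g u where g: "g \<in> ?A" "lead g u"
      "\<And>h v. h \<in> ?A \<Longrightarrow> lead h v \<Longrightarrow> \<not> revlex_less v u"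
    using exists_minimal_lead[of ?A n] by blast
  have "\<not> lead q u" if q: "q \<in> W" for q
  proof
    assume lq: "lead q u"
    let ?h = "g - Poly_Mapping.single 0 (Poly_Mapping.lookup g u / Poly_Mapping.lookup q u) * q"
    have "?h - f = (g - f) - Poly_Mapping.single 0 (Poly_Mapping.lookup g u / Poly_Mapping.lookup q u) * q"
      by simp
    also have "\<dots> \<in> W" using g(1) by (intro diff[OF _ scale[OF q]]) simp
    finally have hA: "?h \<in> ?A" using g(1) W q by auto
    then have "?h \<noteq> 0" using \<open>0 \<notin> ?A\<close> by metis
    then obtain v where v: "lead ?h v" using lead_exists by blast
    then have "revlex_less v u" using lead_cancel[OF g(2) lq] unfolding lead_def by blast
    with g(3)[OF hA v] show False by blast
  qed
  with g that show ?thesis by blast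
qed


section \<open>Dickson's lemma and the ascending chain condition\<close>

lemma nat_seq_mono_subseq:
  fixes f :: "nat \<Rightarrow> nat"
  obtains \<phi> :: "nat \<Rightarrow> nat" where "strict_mono \<phi>" "\<And>i k. i \<le> k \<Longrightarrow> f (\<phi> i) \<le> f (\<phi> k)"
proof -
  obtain \<phi> :: "nat \<Rightarrow> nat" where \<phi>: "strict_mono \<phi>" "monoseq (\<lambda>k. f (\<phi> k))"
    using seq_monosub[of f] by blast
  show ?thesis
  proof (cases "\<forall>i k. i \<le> k \<longrightarrow> f (\<phi> i) \<le> f (\<phi> k)")
    case True
    with \<phi>(1) that show ?thesis by blast
  next
    case False
    with \<phi>(2) have dec: "\<And>i k. i \<le> k \<Longrightarrow> f (\<phi> k) \<le> f (\<phi> i)"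
      unfolding monoseq_def by blast
    \<comment> \<open>A weakly decreasing sequence of naturals is constant once it has reached its
      minimum.\<close>
    obtain m where m: "\<And>i. f (\<phi> m) \<le> f (\<phi> i)"
      using ex_has_least_nat[of "\<lambda>_. True" 0 "\<lambda>i. f (\<phi> i)"] by blast
    show ?thesis
    proof (rule that)
      show "strict_mono (\<lambda>i. \<phi> (m + i))" using \<phi>(1) by (simp add: strict_mono_def)
      show "f (\<phi> (m + i)) \<le> f (\<phi> (m + k))" for i k
        using dec[of m "m + i"] m[of "m + k"] by simp
    qed
  qed
qed

text \<open>A subsequence is refined once for each variable; along the final one all exponents grow
  weakly, so its first two members already compare.\<close>

lemma dickson:
  assumes "\<And>k. s k \<in> mons n"
  obtains i k :: nat where "i < k" "mdvd (s i) (s k)"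
proof -
  have "\<exists>\<phi> :: nat \<Rightarrow> nat. strict_mono \<phi> \<and>
      (\<forall>a\<in>A. \<forall>i k. i \<le> k \<longrightarrow> Poly_Mapping.lookup (s (\<phi> i)) a \<le> Poly_Mapping.lookup (s (\<phi> k)) a)"
    if "finite A" for A
    using that
  proof (induction A)
    case empty
    show ?case by (intro exI[of _ id]) (simp add: strict_mono_def)
  next
    case (insert b A)
    then obtain \<phi> :: "nat \<Rightarrow> nat" where \<phi>: "strict_mono \<phi>"
      "\<And>a i k. a \<in> A \<Longrightarrow> i \<le> k \<Longrightarrow> Poly_Mapping.lookup (s (\<phi> i)) a \<le> Poly_Mapping.lookup (s (\<phi> k)) a"
      by blast
    obtain \<psi> :: "nat \<Rightarrow> nat" where \<psi>: "strict_mono \<psi>"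
      "\<And>i k. i \<le> k \<Longrightarrow> Poly_Mapping.lookup (s (\<phi> (\<psi> i))) b \<le> Poly_Mapping.lookup (s (\<phi> (\<psi> k))) b"
      using nat_seq_mono_subseq[of "\<lambda>i. Poly_Mapping.lookup (s (\<phi> i)) b"] by blast
    have "strict_mono (\<lambda>i. \<phi> (\<psi> i))" using \<phi>(1) \<psi>(1) by (simp add: strict_mono_def)
    with \<phi>(2) \<psi> show ?case
      by (intro exI[of _ "\<lambda>i. \<phi> (\<psi> i)"]) (auto simp: strict_mono_less_eq)
  qed
  then obtain \<phi> :: "nat \<Rightarrow> nat" where \<phi>: "strict_mono \<phi>"
    "\<And>a i k. a \<in> {1..n} \<Longrightarrow> i \<le> k \<Longrightarrow> Poly_Mapping.lookup (s (\<phi> i)) a \<le> Poly_Mapping.lookup (s (\<phi> k)) a"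
    by (metis finite_atLeastAtMost)
  have "Poly_Mapping.lookup (s k) a = 0" if "a \<notin> {1..n}" for a k
    using assms[of k] that by (auto simp: mons_def in_keys_iff)
  with \<phi>(2)[of _ 0 1] have "mdvd (s (\<phi> 0)) (s (\<phi> 1))"
    unfolding mdvd_def by (metis le_numeral_extra(3) zero_le_one)
  with \<phi>(1) that[of "\<phi> 0" "\<phi> 1"] show ?thesis by (simp add: strict_mono_def)
qed

lemma finite_mdvd_antichain:
  assumes "U \<subseteq> mons n" and anti: "\<And>u v. u \<in> U \<Longrightarrow> v \<in> U \<Longrightarrow> mdvd u v \<Longrightarrow> u = v"
  shows "finite U"
proof (rule ccontr)
  assume "infinite U"
  then obtain s :: "nat \<Rightarrow> mon" where s: "inj s" "range s \<subseteq> U"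
    by (meson infinite_countable_subset)
  then have U: "s k \<in> U" for k by blast
  then have "s k \<in> mons n" for k using assms(1) by blast
  then obtain i k where "i < k" "mdvd (s i) (s k)" by (rule dickson)
  then have "i < k" "s i = s k" using anti[OF U U] by blast+
  with s(1) show False by (auto dest: injD)
qed

text \<open>Noetherianity by leading monomials. In a strictly ascending chain, reduction produces at
  each step a leading monomial that the preceding ideal does not have. By Dickson's lemma an earlier
  one of these divides a later one, and a monomial multiple then realises the later one inside the
  ideal that should lack it.\<close>

lemma exists_maximal_ideal:
  assumes ne: "\<A> \<noteq> {}" and id: "\<And>J. J \<in> \<A> \<Longrightarrow> ideal J (mpoly_ring n :: ('k::field) mpoly ring)"
  shows "\<exists>J\<in>\<A>. \<forall>K\<in>\<A>. J \<subseteq> K \<longrightarrow> K = J"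
proof (rule ccontr)
  assume "\<not> ?thesis"
  then have step: "\<exists>K\<in>\<A>. J \<subset> K" if "J \<in> \<A>" for J using that by blast
  obtain J0 where "J0 \<in> \<A>" using ne by blast
  then have "\<exists>J :: nat \<Rightarrow> 'k mpoly set. \<forall>k. J k \<in> \<A> \<and> J k \<subset> J (Suc k)"
    by (intro dependent_nat_choice) (use step in blast)+
  then obtain J :: "nat \<Rightarrow> 'k mpoly set" where J: "\<And>k. J k \<in> \<A>" "\<And>k. J k \<subset> J (Suc k)"
    by metis
  have mono: "J i \<subseteq> J k" if "i \<le> k" for i k
    by (rule lift_Suc_mono_le[of J, OF _ that]) (use J(2) in blast)
  have "\<exists>g u. g \<in> J (Suc k) \<and> lead g u \<and> (\<forall>q\<in>J k. \<not> lead q u)" for k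
  proof -
    note D = ideal_polysD[OF id[OF J(1)]]
    obtain f where f: "f \<in> J (Suc k)" "f \<notin> J k" using J(2) by blast
    then have fp: "f \<in> polys n" using D(1) by blast
    obtain g u where g: "g - f \<in> J k" "lead g u" "\<And>q. q \<in> J k \<Longrightarrow> \<not> lead q u"
      using reduced_lead[OF D(1) D(5) D(6) fp f(2) D(2)] by (metis single_polys zero_mons)
    have "f + (g - f) \<in> J (Suc k)" using D(3)[OF f(1)] g(1) J(2) by blast
    with g show ?thesis by auto
  qed
  then obtain g u where g: "\<And>k. g k \<in> J (Suc k)" "\<And>k. lead (g k) (u k)"
      "\<And>k q. q \<in> J k \<Longrightarrow> \<not> lead q (u k)"
    by metis
  have u: "u k \<in> mons n" for k
    using lead_mons[OF g(2)] g(1) ideal_polysD(1)[OF id[OF J(1)]] by blast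
  then obtain i k where ik: "i < k" "mdvd (u i) (u k)" by (rule dickson)
  have "u k - u i \<in> mons n"
    using u[of k] mons_add[of "u i" "u k - u i" n] mdvd_add_diff[OF ik(2)] by simp
  then have "Poly_Mapping.single (u k - u i) 1 * g i \<in> J (Suc i)"
    using g(1) by (intro ideal_polysD(6)[OF id[OF J(1)]]) auto
  moreover have "J (Suc i) \<subseteq> J k" using mono ik(1) by simp
  moreover have "lead (Poly_Mapping.single (u k - u i) 1 * g i) (u k)"
    using lead_single_mult[OF g(2), of 1 "u k - u i" i] mdvd_add_diff[OF ik(2)] by (simp add: add.commute)
  ultimately show False using g(3) by blast
qed


section \<open>Quotients and filter-regular elements\<close>

lemma coset_eq_iff:
  assumes "ideal J (mpoly_ring n)"
  shows "J +>\<^bsub>mpoly_ring n\<^esub> p = J +>\<^bsub>mpoly_ring n\<^esub> q \<longleftrightarrow> p - q \<in> J"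
proof -
  note D = ideal_polysD[OF assms]
  have mem: "x \<in> J +>\<^bsub>mpoly_ring n\<^esub> p \<longleftrightarrow> x - p \<in> J" for x p
    by (auto simp: a_r_coset_def' intro: bexI[of _ "x - p"])
  show ?thesis
  proof
    assume "J +>\<^bsub>mpoly_ring n\<^esub> p = J +>\<^bsub>mpoly_ring n\<^esub> q"
    moreover have "p \<in> J +>\<^bsub>mpoly_ring n\<^esub> p" by (simp add: mem D(2))
    ultimately show "p - q \<in> J" by (simp add: mem)
  next
    assume pq: "p - q \<in> J"
    have "x - p \<in> J \<longleftrightarrow> x - q \<in> J" for x
      using D(3)[OF _ pq, of "x - p"] D(5)[OF _ pq, of "x - q"] by auto
    then show "J +>\<^bsub>mpoly_ring n\<^esub> p = J +>\<^bsub>mpoly_ring n\<^esub> q" by (auto simp: mem)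
  qed
qed

lemma quot_module_simps:
  assumes "ideal J (mpoly_ring n)"
  shows "carrier (quot_module (mpoly_ring n) J) = (\<lambda>p. J +>\<^bsub>mpoly_ring n\<^esub> p) ` polys n"
    and "zero (quot_module (mpoly_ring n) J) = J +>\<^bsub>mpoly_ring n\<^esub> 0"
    and "p \<in> polys n \<Longrightarrow> q \<in> polys n \<Longrightarrow>
      (J +>\<^bsub>mpoly_ring n\<^esub> p) \<oplus>\<^bsub>quot_module (mpoly_ring n) J\<^esub> (J +>\<^bsub>mpoly_ring n\<^esub> q) =
       J +>\<^bsub>mpoly_ring n\<^esub> (p + q)"
    and "p \<in> polys n \<Longrightarrow> q \<in> polys n \<Longrightarrow>
      p \<odot>\<^bsub>quot_module (mpoly_ring n) J\<^esub> (J +>\<^bsub>mpoly_ring n\<^esub> q) = J +>\<^bsub>mpoly_ring n\<^esub> (p * q)"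
proof -
  interpret ideal J "mpoly_ring n :: 'a mpoly ring" by fact
  show "carrier (quot_module (mpoly_ring n) J) = (\<lambda>p. J +>\<^bsub>mpoly_ring n\<^esub> p) ` polys n"
    by (auto simp: quot_module_def FactRing_def A_RCOSETS_def')
  show "zero (quot_module (mpoly_ring n) J) = J +>\<^bsub>mpoly_ring n\<^esub> 0"
    by (simp add: quot_module_def FactRing_def a_r_coset_def')
  show "p \<in> polys n \<Longrightarrow> q \<in> polys n \<Longrightarrow>
      (J +>\<^bsub>mpoly_ring n\<^esub> p) \<oplus>\<^bsub>quot_module (mpoly_ring n) J\<^esub> (J +>\<^bsub>mpoly_ring n\<^esub> q) =
       J +>\<^bsub>mpoly_ring n\<^esub> (p + q)"
    using a_rcos_sum[of p q] by (simp add: quot_module_def FactRing_def)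
  show "p \<in> polys n \<Longrightarrow> q \<in> polys n \<Longrightarrow>
      p \<odot>\<^bsub>quot_module (mpoly_ring n) J\<^esub> (J +>\<^bsub>mpoly_ring n\<^esub> q) = J +>\<^bsub>mpoly_ring n\<^esub> (p * q)"
    using rcoset_mult_add[of p q] by (simp add: quot_module_def FactRing_def)
qed

definition colon :: "nat \<Rightarrow> ('k::field) mpoly set \<Rightarrow> 'k mpoly \<Rightarrow> 'k mpoly set" where
  "colon n J h = {a \<in> polys n. a * h \<in> J}"

lemma ideal_colon:
  assumes "ideal J (mpoly_ring n)" "h \<in> polys n"
  shows "ideal (colon n J h) (mpoly_ring n)"
  by (rule ideal_polysI)
    (use assms ideal_polysD[OF assms(1)] in \<open>auto simp: colon_def distrib_right mult.assoc\<close>)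

text \<open>
  A colon ideal \<open>J : h\<close>, with \<open>h\<close> a multiple of \<open>f\<close> not killed by a power of \<open>x\<^sub>j\<close>, that is
  maximal among such ideals is an associated prime without \<open>x\<^sub>j\<close>.
\<close>

lemma filter_regular_torsion:
  assumes J: "ideal J (mpoly_ring n)" and z: "z \<in> polys n"
    and reg: "\<And>P. P \<in> assoc_primes (mpoly_ring n) (quot_module (mpoly_ring n) J) \<Longrightarrow>
      P \<noteq> max_ideal n \<Longrightarrow> z \<notin> P"
    and f: "f \<in> polys n" "z * f \<in> J" and j: "j \<in> {1..n}"
  shows "\<exists>N. Var j ^ N * f \<in> J"
proof (rule ccontr)
  interpret R: cring "mpoly_ring n :: 'a mpoly ring" by (rule mpoly_ring_cring)
  note D = ideal_polysD[OF J]
  assume tor: "\<nexists>N. Var j ^ N * f \<in> J"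
  \<comment> \<open>The first condition puts \<open>z\<close> into every colon ideal considered, the
    second keeps x_j out of all of them.\<close>
  define H where "H = {h \<in> polys n. z * h \<in> J \<and> (\<forall>N. Var j ^ N * h \<notin> J)}"
  have ne: "colon n J ` H \<noteq> {}" using tor f by (auto simp: H_def)
  have id: "ideal K (mpoly_ring n)" if "K \<in> colon n J ` H" for K
    using that ideal_colon[OF J] by (auto simp: H_def)
  obtain P where P: "P \<in> colon n J ` H"
      and Pmax: "\<And>K. K \<in> colon n J ` H \<Longrightarrow> P \<subseteq> K \<Longrightarrow> K = P"
    by (meson exists_maximal_ideal[OF ne id])
  obtain h where h: "h \<in> polys n" "z * h \<in> J" "\<And>N. Var j ^ N * h \<notin> J" and Ph: "P = colon n J h"
    using P by (auto simp: H_def)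
  \<comment> \<open>Multiplying \<open>h\<close> by \<open>c\<close> can only enlarge the colon
    ideal, so by maximality it stays the same as long as \<open>c * h\<close> remains in
    \<open>H\<close>.\<close>
  have enlarge: "colon n J (c * h) = P" if c: "c \<in> polys n" and ct: "\<And>N. Var j ^ N * (c * h) \<notin> J" for c
  proof (rule Pmax)
    have "z * (c * h) = c * (z * h)" by (simp add: mult.left_commute)
    then have "z * (c * h) \<in> J" using D(6)[OF h(2) c] by (simp only:)
    then show "colon n J (c * h) \<in> colon n J ` H" using c ct h(1) by (auto simp: H_def)
    have "a * (c * h) \<in> J" if "a * h \<in> J" for a
      using D(6)[OF that c] by (simp add: mult.left_commute)
    then show "P \<subseteq> colon n J (c * h)" by (auto simp: Ph colon_def)
  qed
  have "primeideal P (mpoly_ring n)"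
  proof (rule primeidealI)
    show "ideal P (mpoly_ring n)" unfolding Ph by (rule ideal_colon[OF J h(1)])
    show "cring (mpoly_ring n :: 'a mpoly ring)" by (rule mpoly_ring_cring)
    have "1 \<notin> P" using h(3)[of 0] by (simp add: Ph colon_def)
    then show "polys n \<noteq> P" by auto
    fix a b :: "'a mpoly"
    assume ab: "a \<in> polys n" "b \<in> polys n" "a \<otimes>\<^bsub>mpoly_ring n\<^esub> b \<in> P"
    then have abh: "a * (b * h) \<in> J" by (simp add: Ph colon_def mult.assoc)
    show "a \<in> P \<or> b \<in> P"
    \<comment> \<open>Either a power x_j^N kills \<open>b * h\<close>, and \<open>b\<close> lies in
      the colon ideal of x_j^N h, or \<open>b * h\<close> is again in \<open>H\<close> and
      \<open>a\<close> lies in its colon ideal. Both colon ideals equal \<open>P\<close>.\<close>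
    proof (cases "\<exists>N. Var j ^ N * (b * h) \<in> J")
      case True
      then obtain N where N: "Var j ^ N * (b * h) \<in> J" by blast
      have "Var j ^ M * (Var j ^ N * h) \<notin> J" for M
        using h(3)[of "M + N"] by (simp add: power_add mult.assoc)
      then have "colon n J (Var j ^ N * h) = P" using j by (intro enlarge) auto
      moreover have "b \<in> colon n J (Var j ^ N * h)"
        using ab(2) N by (simp add: colon_def mult.left_commute)
      ultimately show ?thesis by simp
    next
      case False
      then have "colon n J (b * h) = P" using ab(2) by (intro enlarge) auto
      moreover have "a \<in> colon n J (b * h)" using ab(1) abh by (simp add: colon_def)
      ultimately show ?thesis by simp
    qed
  qed
  moreover have "P = {a \<in> polys n. a \<odot>\<^bsub>quot_module (mpoly_ring n) J\<^esub> (J +>\<^bsub>mpoly_ring n\<^esub> h) =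
      \<zero>\<^bsub>quot_module (mpoly_ring n) J\<^esub>}"
    unfolding Ph colon_def using h(1)
    by (intro Collect_cong conj_cong refl) (simp add: quot_module_simps[OF J] coset_eq_iff[OF J])
  ultimately have "P \<in> assoc_primes (mpoly_ring n) (quot_module (mpoly_ring n) J)"
    using h(1) by (auto simp: assoc_primes_def quot_module_simps(1)[OF J])
  moreover have "z \<in> P" using z h(2) by (simp add: Ph colon_def)
  moreover have "Var j \<notin> P" using h(3)[of 1] by (simp add: Ph colon_def)
  moreover have "Var ` {1..n} \<subseteq> (polys n :: 'a mpoly set)" using Var_polys by blast
  \<comment> \<open>x_j lies in the maximal ideal but not in \<open>P\<close>, so \<open>P\<close>
    is one of the primes that \<open>z\<close> has to avoid.\<close>
  then have "Var j \<in> (max_ideal n :: 'a mpoly set)"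
    using R.genideal_self[of "Var ` {1..n}"] j by (auto simp: max_ideal_def)
  ultimately show False using reg by blast
qed


section \<open>Bounding the degrees by the initial ideal\<close>

lemma finite_min_gens:
  assumes U: "U \<subseteq> mons n" and J: "J = genideal (mpoly_ring n) (mpoly_of_mon ` U)"
  shows "finite (min_gens (J :: ('k::field) mpoly set))"
proof (rule finite_mdvd_antichain)
  show "min_gens J \<subseteq> mons n" using min_gens_least[OF U J] U by blast
qed (auto simp: min_gens_def)

text \<open>\<open>mon_lcm\<close> is made from a bare function, so its exponents can be read off
  only after its support is shown to be finite; for this the support is enclosed in the union of the
  supports of \<open>U\<close>.\<close>

lemma lookup_mon_lcm_ge:
  assumes U: "finite U" "u \<in> U"
  shows "Poly_Mapping.lookup u j \<le> Poly_Mapping.lookup (mon_lcm U) j"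
proof -
  define L where "L j = Max (insert 0 ((\<lambda>u. Poly_Mapping.lookup u j) ` U))" for j
  have zero: "L j = 0" if "j \<notin> (\<Union>u\<in>U. Poly_Mapping.keys u)" for j
  proof -
    have "(\<lambda>u. Poly_Mapping.lookup u j) ` U \<subseteq> {0}" using that by (auto simp: in_keys_iff)
    then have "insert 0 ((\<lambda>u. Poly_Mapping.lookup u j) ` U) = {0}" by blast
    then show ?thesis by (simp only: L_def Max_singleton)
  qed
  have "{j. L j \<noteq> 0} \<subseteq> (\<Union>u\<in>U. Poly_Mapping.keys u)"
  proof
    fix j assume "j \<in> {j. L j \<noteq> 0}"
    with zero[of j] show "j \<in> (\<Union>u\<in>U. Poly_Mapping.keys u)" by (simp only: mem_Collect_eq) blast
  qed
  then have "finite {j. L j \<noteq> 0}"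
    by (rule finite_subset) (use U in simp)
  then have "Poly_Mapping.lookup (mon_lcm U) j = L j"
    unfolding mon_lcm_def L_def[abs_def, symmetric] by (subst lookup_Abs_poly_mapping) simp_all
  moreover have "Poly_Mapping.lookup u j \<le> L j" unfolding L_def using U by (intro Max_ge) auto
  ultimately show ?thesis by simp
qed

definition lead_mons_of :: "('k::field) mpoly set \<Rightarrow> mon set" where
  "lead_mons_of I = in_mon ` (I - {0})"

lemma init_ideal_eq: "init_ideal n I = genideal (mpoly_ring n) (mpoly_of_mon ` lead_mons_of I)"
  unfolding init_ideal_def lead_mons_of_def by (rule arg_cong) auto

lemma lead_mons_of_subset:
  assumes "I \<subseteq> polys n"
  shows "lead_mons_of I \<subseteq> mons n"
proof
  fix v assume "v \<in> lead_mons_of I"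
  then obtain f where f: "v = in_mon f" "f \<in> I" "f \<noteq> 0" by (auto simp: lead_mons_of_def)
  moreover obtain w where w: "lead f w" using lead_exists[OF f(3)] by blast
  ultimately have "lead f v" by (simp add: lead_in_mon)
  then show "v \<in> mons n" using lead_mons f(2) assms by blast
qed

text \<open>
  Among monomials of the same degree, those divisible by one of \<open>x\<^sub>m\<^sub>+\<^sub>1, \<dots>, x\<^sub>n\<close> come after
  those that are not; so a leading monomial of \<open>f + h\<close> in \<open>x\<^sub>1, \<dots>, x\<^sub>m\<close>, with \<open>h\<close> in the
  ideal of \<open>x\<^sub>m\<^sub>+\<^sub>1, \<dots>, x\<^sub>n\<close>, is the leading monomial of \<open>f\<close>.
\<close>

lemma lead_mod_last_variables:
  assumes q: "homogeneous d q" "lead q w" and f: "homogeneous d f" and w: "Poly_Mapping.keys w \<subseteq> {1..m}"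
    and diff: "\<And>v. v \<in> Poly_Mapping.keys (q - f) \<Longrightarrow> \<exists>l>m. Poly_Mapping.lookup v l > 0"
  shows "lead f w"
  unfolding lead_def
proof (intro conjI ballI impI)
  have w0: "Poly_Mapping.lookup w l = 0" if "l > m" for l
    using w that not_in_keys_iff_lookup_eq_zero[of l w] by force
  have "w \<notin> Poly_Mapping.keys (q - f)" using diff w0 by (metis less_numeral_extra(3))
  then have "Poly_Mapping.lookup f w = Poly_Mapping.lookup q w"
    by (simp add: in_keys_iff lookup_minus)
  then show "w \<in> Poly_Mapping.keys f" using q(2) by (simp add: lead_def in_keys_iff)
  fix v assume v: "v \<in> Poly_Mapping.keys f" "v \<noteq> w"
  show "revlex_less v w"
  proof (cases "v \<in> Poly_Mapping.keys q")
    case True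
    then show ?thesis using q(2) v by (simp add: lead_def)
  next
    case False
    then have "v \<in> Poly_Mapping.keys (q - f)" using v(1) by (simp add: in_keys_iff lookup_minus)
    then obtain l where l: "l > m" "Poly_Mapping.lookup v l > 0" using diff by blast
    obtain j where j: "Poly_Mapping.lookup v j \<noteq> Poly_Mapping.lookup w j"
        "\<And>i. i > j \<Longrightarrow> Poly_Mapping.lookup v i = Poly_Mapping.lookup w i"
      using last_difference[OF v(2)] by blast
    \<comment> \<open>\<open>v\<close> involves x_l and \<open>w\<close> does not, so their last
      difference is at some \<open>j >= l\<close>, where \<open>w\<close> has exponent 0. The larger
      exponent there makes \<open>v\<close> the smaller monomial.\<close>
    have "\<not> l > j" using j(2)[of l] l w0[of l] by auto
    then have "Poly_Mapping.lookup w j < Poly_Mapping.lookup v j"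
      using j(1) w0[of j] l(1) by simp
    moreover have "int (mdeg v) = d" "int (mdeg w) = d"
      using f v(1) lead_mdeg[OF q(2,1)] by (auto simp: homogeneous_def)
    ultimately show ?thesis using j(2) by (auto simp: revlex_less_def)
  qed
qed

lemma Var_power: "Var j ^ N = Poly_Mapping.single (Poly_Mapping.single j N) 1"
  by (induction N) (simp_all add: Var_def mpoly_of_mon_def mult_single flip: single_add)

text \<open>\<open>J\<close> stands for Q_i and is described by what the argument draws on: it
  agrees with \<open>I\<close> modulo the last \<open>i\<close> variables, contains these variables,
  and whatever x_{n-i} kills modulo \<open>J\<close> is also killed by a power of each
  variable.\<close>

lemma regular_above_of_init:
  assumes I: "ideal I (mpoly_ring n)" and gr: "graded I"
    and J: "ideal J (mpoly_ring n)" and IJ: "I \<subseteq> J"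
    and J_mod: "\<And>q. q \<in> J \<Longrightarrow> \<exists>f\<in>I. \<forall>v\<in>Poly_Mapping.keys (q - f). \<exists>l>n - i. Poly_Mapping.lookup v l > 0"
    and J_Var: "\<And>l. l \<in> {n - i + 1..n} \<Longrightarrow> Var l \<in> J"
    and i: "i < n"
    and tor: "\<And>f j. f \<in> polys n \<Longrightarrow> Var (n - i) * f \<in> J \<Longrightarrow> j \<in> {1..n} \<Longrightarrow> \<exists>N. Var j ^ N * f \<in> J"
  shows "regular_above n J (n - i) (int (mdeg (gen_lcm n I i)) - int n + int i)"
  unfolding regular_above_def
proof (intro allI impI, rule ccontr)
  fix s and f :: "'a mpoly"
  assume s: "s > int (mdeg (gen_lcm n I i)) - int n + int i" and f: "f \<in> polys n" "homogeneous s f"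
    and xf: "Var (n - i) * f \<in> J" and nf: "f \<notin> J"
  note DI = ideal_polysD[OF I] and DJ = ideal_polysD[OF J]
  \<comment> \<open>Reducing only by elements of degree \<open>s\<close> keeps the result
    homogeneous of the degree of \<open>f\<close>.\<close>
  let ?W = "{q \<in> J. homogeneous s q}" and ?m = "n - i"
  have "homogeneous s (Poly_Mapping.single 0 c * q)" if "homogeneous s q" for c and q :: "'a mpoly"
    using that homogeneous_mult[of 0 "Poly_Mapping.single 0 c" s q] by (simp add: homogeneous_def mdeg_def)
  then obtain g u where g: "g \<in> polys n" "g - f \<in> ?W" "lead g u" and u: "\<And>q. q \<in> ?W \<Longrightarrow> \<not> lead q u"
    using reduced_lead[of ?W n f] f nf DJ homogeneous_diff[of s]
    by (smt (verit) homogeneous_0 mem_Collect_eq single_polys subset_iff zero_mons)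
  have gs: "homogeneous s g" using homogeneous_add[OF f(2), of "g - f"] g(2) by simp
  have us: "int (mdeg u) = s" by (rule lead_mdeg[OF g(3) gs])
  have un: "u \<in> mons n" by (rule lead_mons[OF g(3,1)])
  \<comment> \<open>The reduction excludes leading monomials of degree \<open>s\<close> only. A
    homogeneous element of smaller degree whose leading monomial divides \<open>u\<close> is
    multiplied up to degree \<open>s\<close>.\<close>
  have u_notin: False if q: "q \<in> J" "homogeneous (int (mdeg v)) q" "lead q v" "mdvd v u" for q v
  proof -
    have eq: "u - v + v = u" using mdvd_add_diff[OF q(4)] by (simp add: add.commute)
    then have "u - v \<in> mons n" using un mons_add by metis
    then have "Poly_Mapping.single (u - v) 1 * q \<in> J" using q(1) by (intro DJ(6)) auto
    moreover have "homogeneous (int (mdeg (u - v)) + int (mdeg v)) (Poly_Mapping.single (u - v) 1 * q)"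
      using q(2) by (intro homogeneous_mult) (simp_all add: homogeneous_def)
    then have "homogeneous s (Poly_Mapping.single (u - v) 1 * q)"
      using eq us by (metis mdeg_add of_nat_add)
    moreover have "lead (Poly_Mapping.single (u - v) 1 * q) u"
      using lead_single_mult[OF q(3), of 1 "u - v"] eq by simp
    ultimately show False using u by blast
  qed
  have u_keys: "Poly_Mapping.keys u \<subseteq> {1..?m}"
  proof
    fix l assume l: "l \<in> Poly_Mapping.keys u"
    then have "l \<in> {1..n}" using un by (auto simp: mons_def)
    moreover have False if "l \<in> {?m + 1..n}"
    proof (rule u_notin[OF J_Var[OF that]])
      show "mdvd (Poly_Mapping.single l 1) u"
        using l by (auto simp: mdvd_def lookup_single when_def in_keys_iff)
      show "lead (Var l :: 'a mpoly) (Poly_Mapping.single l 1)"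
        by (simp add: lead_def Var_def mpoly_of_mon_def)
    qed simp
    ultimately show "l \<in> {1..?m}" by fastforce
  qed
  have xg: "Var ?m * g \<in> J"
  proof -
    have "Var ?m * (g - f) \<in> J" using g(2) i by (intro DJ(6)) auto
    from DJ(3)[OF xf this] show ?thesis by (simp add: algebra_simps)
  qed
  let ?U = "{v \<in> min_gens (init_ideal n I). \<forall>j\<in>{n - i + 1..n}. \<not> mdvd (Poly_Mapping.single j 1) v}"
  have finU: "finite ?U"
    using finite_min_gens[OF lead_mons_of_subset[OF DI(1)] init_ideal_eq] by simp
  have exponent: "Suc (Poly_Mapping.lookup u j) \<le> Poly_Mapping.lookup (gen_lcm n I i) j" if j: "j \<in> {1..?m}" for j
  proof -
    have "j \<in> {1..n}" using j by auto
    then obtain N where "Var j ^ N * g \<in> J" using tor[OF g(1) xg] by blast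
    then obtain p where p: "p \<in> I"
        "\<And>v. v \<in> Poly_Mapping.keys (Var j ^ N * g - p) \<Longrightarrow> \<exists>l>?m. Poly_Mapping.lookup v l > 0"
      using J_mod by blast
    let ?w = "Poly_Mapping.single j N + u" and ?d = "int N + s"
    have lq: "lead (Var j ^ N * g) ?w"
      unfolding Var_power using g(3) by (rule lead_single_mult) simp
    have hq: "homogeneous ?d (Var j ^ N * g)"
      using homogeneous_mult[OF homogeneous_power[OF homogeneous_Var] gs, of N j] by simp
    have w: "Poly_Mapping.keys ?w \<subseteq> {1..?m}"
      using Poly_Mapping.keys_add[of "Poly_Mapping.single j N" u] u_keys j
      by (auto split: if_splits)
    \<comment> \<open>\<open>p\<close> may be inhomogeneous. Its component of degree
      \<open>?d\<close> lies in \<open>I\<close> too, and the difference still consists of monomials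
      in the last variables.\<close>
    have "Var j ^ N * g - hcomp ?d p = hcomp ?d (Var j ^ N * g - p)"
      using hcomp_homogeneous[OF hq, of ?d] hcomp_add[of ?d "Var j ^ N * g" "- p"] by (simp add: hcomp_uminus)
    then have "lead (hcomp ?d p) ?w"
      using p(2) by (intro lead_mod_last_variables[OF hq lq _ w]) (auto simp: keys_hcomp)
    moreover have "hcomp ?d p \<in> I" using gr p(1) by (simp add: graded_def)
    ultimately have "?w \<in> lead_mons_of I"
      unfolding lead_mons_of_def by (metis Diff_iff image_eqI lead_in_mon lead_nonzero singletonD)
    moreover have "mpoly_of_mon ` lead_mons_of I \<subseteq> (polys n :: 'a mpoly set)"
      using lead_mons_of_subset[OF DI(1)] by (auto simp: mpoly_of_mon_def)
    ultimately have "(mpoly_of_mon ?w :: 'a mpoly) \<in> init_ideal n I"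
      using cring.axioms(1)[OF mpoly_ring_cring] unfolding init_ideal_eq
      by (meson image_eqI ring.genideal_self subsetD)
    then obtain v where v: "v \<in> min_gens (init_ideal n I)" "mdvd v ?w"
      using mem_min_gens by blast
    have vu: "Poly_Mapping.lookup v l \<le> (if l = j then N else 0) + Poly_Mapping.lookup u l" for l
      using v(2) by (auto simp: mdvd_def lookup_add lookup_single when_def split: if_splits)
    \<comment> \<open>A minimal generator is itself the leading monomial of an element of
      \<open>I\<close>, hence of a homogeneous element of \<open>J\<close>.\<close>
    have nvu: "\<not> mdvd v u"
    proof
      assume vu: "mdvd v u"
      have "v \<in> lead_mons_of I"
        using v(1) min_gens_least[OF lead_mons_of_subset[OF DI(1)] init_ideal_eq] by blast
      then obtain h where h: "h \<in> I" "h \<noteq> 0" "v = in_mon h" by (auto simp: lead_mons_of_def)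
      then have "lead h v" using lead_exists lead_in_mon by metis
      then have "lead (hcomp (int (mdeg v)) h) v" by (rule lead_hcomp)
      moreover have "hcomp (int (mdeg v)) h \<in> J" using h(1) gr IJ by (auto simp: graded_def)
      ultimately show False using u_notin[OF _ homogeneous_hcomp _ vu] by blast
    qed
    have "\<not> mdvd (Poly_Mapping.single l 1) v" if l: "l \<in> {n - i + 1..n}" for l
    proof -
      have "l \<notin> Poly_Mapping.keys u" "l \<noteq> j" using l u_keys j by auto
      then have "Poly_Mapping.lookup v l = 0" using vu[of l] by (simp add: in_keys_iff)
      then show ?thesis by (auto simp: mdvd_def intro!: exI[of _ l])
    qed
    then have "v \<in> ?U" using v(1) by blast
    then have "Poly_Mapping.lookup v j \<le> Poly_Mapping.lookup (gen_lcm n I i) j"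
      unfolding gen_lcm_def using finU by (intro lookup_mon_lcm_ge)
    \<comment> \<open>\<open>v\<close> divides x_j^N u but not \<open>u\<close>, and these two
      monomials differ only in the exponent at \<open>j\<close>.\<close>
    moreover obtain l where "Poly_Mapping.lookup v l > Poly_Mapping.lookup u l"
      using nvu unfolding mdvd_def by (meson not_le)
    then have "Poly_Mapping.lookup v j > Poly_Mapping.lookup u j"
      using vu[of l] by (cases "l = j") auto
    ultimately show ?thesis by simp
  qed
  \<comment> \<open>Each of the n - i variables contributes one unit of strictness; together they
    make up the summand - n + i of the bound.\<close>
  have "mdeg u + ?m = (\<Sum>j\<in>{1..?m}. Suc (Poly_Mapping.lookup u j))"
    using mdeg_eq[OF _ u_keys] by (simp add: sum_Suc)
  also have "\<dots> \<le> (\<Sum>j\<in>{1..?m}. Poly_Mapping.lookup (gen_lcm n I i) j)"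
    using exponent by (intro sum_mono) auto
  also have "\<dots> \<le> (\<Sum>j\<in>{1..?m} \<union> Poly_Mapping.keys (gen_lcm n I i). Poly_Mapping.lookup (gen_lcm n I i) j)"
    by (intro sum_mono2) auto
  also have "\<dots> = mdeg (gen_lcm n I i)"
    using mdeg_eq[of "{1..?m} \<union> Poly_Mapping.keys (gen_lcm n I i)" "gen_lcm n I i"] by simp
  finally show False using s us i by linarith
qed

section \<open>The ideals generated by I and the last variables\<close>

fun cut_ideal :: "nat \<Rightarrow> ('k::field) mpoly set \<Rightarrow> nat \<Rightarrow> 'k mpoly set" where
  "cut_ideal n I 0 = I"
| "cut_ideal n I (Suc i) = ideal_plus n (cut_ideal n I i) (Var (n - i))"

lemma ideal_cut_ideal:
  assumes "ideal I (mpoly_ring n)" "i \<le> n"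
  shows "ideal (cut_ideal n I i) (mpoly_ring n)"
  using assms(2) by (induction i) (auto intro!: ideal_ideal_plus Var_polys assms)

lemma graded_cut_ideal: "graded I \<Longrightarrow> graded (cut_ideal n I i)"
  by (induction i) (auto intro: graded_ideal_plus)

lemma cut_ideal_superset: "I \<subseteq> cut_ideal n I i"
  using ideal_plus_superset by (induction i) fastforce+

lemma cut_ideal_Var:
  assumes "ideal I (mpoly_ring n)" "i \<le> n" "l \<in> {n - i + 1..n}"
  shows "Var l \<in> cut_ideal n I i"
  using assms(2,3)
proof (induction i)
  case (Suc i)
  show ?case
  proof (cases "l = n - i")
    case True
    then show ?thesis
      using mem_ideal_plus[OF ideal_cut_ideal[OF assms(1)], of i 1 "Var l"] Suc.prems by simp
  next
    case False
    then have "Var l \<in> cut_ideal n I i" using Suc by auto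
    then show ?thesis using ideal_plus_superset by auto
  qed
qed auto

text \<open>Everything added to an element of \<open>I\<close> is a combination of multiples of the
  adjoined variables, so each of its monomials involves one of them.\<close>

lemma cut_ideal_mod:
  assumes "i \<le> n" "q \<in> cut_ideal n I i"
  shows "\<exists>f\<in>I. \<forall>v\<in>Poly_Mapping.keys (q - f). \<exists>l>n - i. Poly_Mapping.lookup v l > 0"
  using assms
proof (induction i arbitrary: q)
  case 0
  then show ?case by (intro bexI[of _ q]) auto
next
  case (Suc i)
  then obtain g e where q: "q = g + Var (n - i) * e" and g: "g \<in> cut_ideal n I i"
    by (auto simp: ideal_plus_def)
  obtain f where f: "f \<in> I" "\<And>v. v \<in> Poly_Mapping.keys (g - f) \<Longrightarrow> \<exists>l>n - i. Poly_Mapping.lookup v l > 0"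
    using Suc.IH[OF _ g] Suc.prems(1) by auto
  have "\<exists>l>n - Suc i. Poly_Mapping.lookup v l > 0" if v: "v \<in> Poly_Mapping.keys (q - f)" for v
  proof -
    have "q - f = (g - f) + Var (n - i) * e" by (simp add: q)
    then have "v \<in> Poly_Mapping.keys ((g - f) + Var (n - i) * e)" using v by (simp only:)
    then consider "v \<in> Poly_Mapping.keys (g - f)" | "v \<in> Poly_Mapping.keys (Var (n - i) * e)"
      using Poly_Mapping.keys_add[of "g - f" "Var (n - i) * e"] by blast
    then show ?thesis
    proof cases
      case 1
      then obtain l where "l > n - i" "Poly_Mapping.lookup v l > 0" using f(2) by blast
      then show ?thesis by (intro exI[of _ l]) auto
    next
      case 2
      then have "mdvd (Poly_Mapping.single (n - i) 1) v"
        by (auto simp: Var_def mpoly_of_mon_def keys_single_mult)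
      then have "Poly_Mapping.lookup v (n - i) > 0"
        unfolding mdvd_def by (metis lookup_single_eq less_le_trans zero_less_one)
      then show ?thesis using Suc.prems(1) by (intro exI[of _ "n - i"]) auto
    qed
  qed
  with f(1) show ?case by blast
qed

text \<open>Links the ideals that occur in \<open>filter_regular\<close> to the extensions by one
  variable at a time on which the induction runs.\<close>

lemma genideal_cut:
  assumes I: "ideal I (mpoly_ring n)" and i: "i \<le> n"
  shows "genideal (mpoly_ring n) (I \<union> (\<lambda>i. Var (n - i)) ` {0..<i}) = cut_ideal n I i"
  using i
proof (induction i)
  case 0
  interpret R: cring "mpoly_ring n :: 'a mpoly ring" by (rule mpoly_ring_cring)
  show ?case
    using R.genideal_minimal[OF I, of I] R.genideal_self[OF ideal_polysD(1)[OF I]] by auto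
next
  case (Suc i)
  let ?A = "I \<union> (\<lambda>i. Var (n - i)) ` {0..<i}"
  have "?A \<subseteq> polys n"
    using ideal_polysD(1)[OF I] Suc.prems by (auto intro!: Var_polys)
  moreover have "I \<union> (\<lambda>i. Var (n - i)) ` {0..<Suc i} = insert (Var (n - i)) ?A"
    by (auto simp: atLeastLessThanSuc)
  ultimately show ?case
    using Suc by (simp add: genideal_insert)
qed

lemma regular_above_cut:
  fixes I :: "('k::field) mpoly set"
  assumes hI: "homogeneous_ideal n I" and t: "t < n"
    and reg: "filter_regular n I (map (\<lambda>i. Var (n - i)) [0..<Suc t])" and i: "i \<le> t"
  shows "regular_above n (cut_ideal n I i) (n - i) (int (mdeg (gen_lcm n I i)) - int n + int i)"
proof -
  have I: "ideal I (mpoly_ring n)" using hI by (simp add: homogeneous_ideal_def)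
  have J: "ideal (cut_ideal n I i) (mpoly_ring n)" using I t i by (intro ideal_cut_ideal) auto
  let ?zs = "map (\<lambda>i. Var (n - i) :: 'k mpoly) [0..<Suc t]"
  have "take i ?zs = map (\<lambda>i. Var (n - i)) [0..<i]"
    using i by (simp add: take_map flip: map_Suc_upt del: upt_Suc)
  then have "set (take i ?zs) = (\<lambda>i. Var (n - i)) ` {0..<i}" by simp
  then have cut: "genideal (mpoly_ring n) (I \<union> set (take i ?zs)) = cut_ideal n I i"
    using genideal_cut[OF I, of i] t i by simp
  have "i < length ?zs" "?zs ! i = Var (n - i)" using i by (simp_all del: upt_Suc)
  then have "Var (n - i) \<notin> P"
    if "P \<in> assoc_primes (mpoly_ring n) (quot_module (mpoly_ring n) (cut_ideal n I i))" "P \<noteq> max_ideal n" for P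
    using reg that cut unfolding filter_regular_def by metis
  then have tor: "\<exists>N. Var j ^ N * f \<in> cut_ideal n I i"
    if "f \<in> polys n" "Var (n - i) * f \<in> cut_ideal n I i" "j \<in> {1..n}" for f j
    using that t i by (intro filter_regular_torsion[OF J, of "Var (n - i)"]) auto
  show ?thesis
    using t i
    by (intro regular_above_of_init I homogeneous_ideal_graded[OF hI] J cut_ideal_superset cut_ideal_mod
        cut_ideal_Var[OF I] tor) auto
qed


section \<open>The Cech complex in terms of cochains\<close>

lemma mpoly_ring_nat_pow: "f \<in> polys n \<Longrightarrow> f [^]\<^bsub>mpoly_ring n\<^esub> (k::nat) = f ^ k"
proof -
  interpret R: cring "mpoly_ring n :: 'a mpoly ring" by (rule mpoly_ring_cring)
  show "f [^]\<^bsub>mpoly_ring n\<^esub> k = f ^ k"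
    by (induction k) (simp_all add: mult.commute)
qed

lemma mpoly_ring_a_inv: "f \<in> polys n \<Longrightarrow> \<ominus>\<^bsub>mpoly_ring n\<^esub> f = - f"
proof -
  interpret R: cring "mpoly_ring n :: 'a mpoly ring" by (rule mpoly_ring_cring)
  show "f \<in> polys n \<Longrightarrow> \<ominus>\<^bsub>mpoly_ring n\<^esub> f = - f"
    by (intro R.minus_equality) auto
qed

lemma mpoly_ring_finprod:
  fixes f :: "'b \<Rightarrow> ('a::field) mpoly"
  assumes "finite A" "\<And>i. i \<in> A \<Longrightarrow> f i \<in> polys n"
  shows "(\<Otimes>\<^bsub>mpoly_ring n\<^esub>i\<in>A. f i) = prod f A"
proof -
  interpret R: cring "mpoly_ring n :: 'a mpoly ring" by (rule mpoly_ring_cring)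
  show ?thesis using assms
    by (induction A) (simp_all add: R.finprod_insert Pi_def)
qed

lemma finprod_Var: "F \<in> faces n p \<Longrightarrow> (\<Otimes>\<^bsub>mpoly_ring n\<^esub>i\<in>F. Var i) = vprod F"
  by (intro mpoly_ring_finprod faces_finite Var_polys faces_mem)

lemma faces_zero: "faces n 0 = {{}}"
  by (auto simp: faces_def dest: finite_subset)

lemma finite_faces: "finite (faces n p)"
  by (rule finite_subset[of _ "Pow {1..n}"]) (auto simp: faces_def)

section \<open>Fractions over S/J on polynomial representatives\<close>

locale mpoly_quotient =
  fixes n :: nat and J :: "('k::field) mpoly set"
  assumes J: "ideal J (mpoly_ring n)"
begin

abbreviation R :: "'k mpoly ring" where "R \<equiv> mpoly_ring n"
abbreviation M :: "('k mpoly, 'k mpoly set) module" where "M \<equiv> quot_module R J"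
abbreviation loc :: "'k mpoly \<Rightarrow> ('k mpoly, ('k mpoly set \<times> nat) set) module" where
  "loc f \<equiv> localisation R M f"

definition fr :: "'k mpoly \<Rightarrow> 'k mpoly \<Rightarrow> nat \<Rightarrow> ('k mpoly set \<times> nat) set" where
  "fr f p k = frac R M f (J +>\<^bsub>R\<^esub> p) k"

text \<open>Equality of p / f^k and q / f^l in the localisation of S/J at \<open>f\<close>.\<close>

definition fr_rel :: "'k mpoly \<Rightarrow> 'k mpoly \<Rightarrow> nat \<Rightarrow> 'k mpoly \<Rightarrow> nat \<Rightarrow> bool" where
  "fr_rel f p k q l \<longleftrightarrow> (\<exists>j. f ^ (j + l) * p - f ^ (j + k) * q \<in> J)"

lemmas J_closed = ideal_polysD[OF J]

lemma fr_rel_refl: "fr_rel f p k p k"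
  by (simp add: fr_rel_def J_closed)

lemma fr_rel_sym: "fr_rel f p k q l \<Longrightarrow> fr_rel f q l p k"
  unfolding fr_rel_def using J_closed(4) by fastforce

lemma fr_rel_trans:
  assumes f: "f \<in> polys n" and "fr_rel f p k q l" "fr_rel f q l s m"
  shows "fr_rel f p k s m"
proof -
  obtain i j where "f ^ (j + l) * p - f ^ (j + k) * q \<in> J" "f ^ (i + m) * q - f ^ (i + l) * s \<in> J"
    using assms by (auto simp: fr_rel_def)
  then have "f ^ (i + m) * (f ^ (j + l) * p - f ^ (j + k) * q) +
      f ^ (j + k) * (f ^ (i + m) * q - f ^ (i + l) * s) \<in> J"
    using f by (intro J_closed(3) J_closed(6)) auto
  also have "f ^ (i + m) * (f ^ (j + l) * p - f ^ (j + k) * q) +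
      f ^ (j + k) * (f ^ (i + m) * q - f ^ (i + l) * s) =
      f ^ (i + j + l + m) * p - f ^ (i + j + l + k) * s"
    by (simp add: algebra_simps power_add)
  finally show ?thesis unfolding fr_rel_def by blast
qed

lemma smult_cls: "a \<in> polys n \<Longrightarrow> p \<in> polys n \<Longrightarrow> a \<odot>\<^bsub>M\<^esub> (J +>\<^bsub>R\<^esub> p) = J +>\<^bsub>R\<^esub> (a * p)"
  by (rule quot_module_simps(4)[OF J])

lemma loc_rel_cls:
  assumes "f \<in> polys n" "p \<in> polys n" "q \<in> polys n"
  shows "((J +>\<^bsub>R\<^esub> p, k), (J +>\<^bsub>R\<^esub> q, l)) \<in> loc_rel R M f \<longleftrightarrow> fr_rel f p k q l"
proof -
  have "J +>\<^bsub>R\<^esub> p \<in> carrier M" "J +>\<^bsub>R\<^esub> q \<in> carrier M"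
    using assms by (auto simp: quot_module_simps(1)[OF J])
  then show ?thesis
    using assms by (simp add: loc_rel_def fr_rel_def smult_cls mpoly_ring_nat_pow coset_eq_iff[OF J])
qed

lemma mem_fr_iff:
  assumes "f \<in> polys n" "p \<in> polys n"
  shows "x \<in> fr f p k \<longleftrightarrow> (\<exists>q\<in>polys n. \<exists>l. x = (J +>\<^bsub>R\<^esub> q, l) \<and> fr_rel f p k q l)"
proof
  assume x: "x \<in> fr f p k"
  obtain v l where vl: "x = (v, l)" by (cases x)
  with x have "v \<in> carrier M" by (simp add: fr_def frac_def loc_rel_def)
  then obtain q where q: "q \<in> polys n" "v = J +>\<^bsub>R\<^esub> q" by (auto simp: quot_module_simps(1)[OF J])
  then have "fr_rel f p k q l"
    using x vl loc_rel_cls[OF assms q(1)] by (simp add: fr_def frac_def)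
  with q vl show "\<exists>q\<in>polys n. \<exists>l. x = (J +>\<^bsub>R\<^esub> q, l) \<and> fr_rel f p k q l" by blast
next
  assume "\<exists>q\<in>polys n. \<exists>l. x = (J +>\<^bsub>R\<^esub> q, l) \<and> fr_rel f p k q l"
  then obtain q l where "q \<in> polys n" "x = (J +>\<^bsub>R\<^esub> q, l)" "fr_rel f p k q l" by blast
  then show "x \<in> fr f p k"
    using loc_rel_cls[OF assms, of q k l] by (simp add: fr_def frac_def)
qed

lemma mem_fr_self: "f \<in> polys n \<Longrightarrow> p \<in> polys n \<Longrightarrow> (J +>\<^bsub>R\<^esub> p, k) \<in> fr f p k"
  using loc_rel_cls[of f p p k k] fr_rel_refl[of f p k] by (simp add: fr_def frac_def)

lemma fr_eq_iff:
  assumes "f \<in> polys n" "p \<in> polys n" "q \<in> polys n"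
  shows "fr f p k = fr f q l \<longleftrightarrow> fr_rel f p k q l"
proof
  assume "fr f p k = fr f q l"
  then have "(J +>\<^bsub>R\<^esub> q, l) \<in> fr f p k" using mem_fr_self assms by simp
  then show "fr_rel f p k q l"
    using loc_rel_cls[OF assms] by (simp add: fr_def frac_def)
next
  assume r: "fr_rel f p k q l"
  have "fr_rel f p k s m \<longleftrightarrow> fr_rel f q l s m" for s m
    using fr_rel_trans[OF assms(1)] fr_rel_sym r by blast
  then have "x \<in> fr f p k \<longleftrightarrow> x \<in> fr f q l" for x
    using assms by (simp add: mem_fr_iff)
  then show "fr f p k = fr f q l" by blast
qed

lemma fr_eqI: "f \<in> polys n \<Longrightarrow> p \<in> polys n \<Longrightarrow> q \<in> polys n \<Longrightarrow> p - q \<in> J \<Longrightarrow> fr f p k = fr f q k"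
  by (subst fr_eq_iff) (auto simp: fr_rel_def simp flip: right_diff_distrib intro!: exI[of _ 0] J_closed(6))

lemma fr_scale: "f \<in> polys n \<Longrightarrow> p \<in> polys n \<Longrightarrow> fr f (f ^ a * p) (k + a) = fr f p k"
  by (subst fr_eq_iff) (auto simp: fr_rel_def J_closed power_add algebra_simps intro!: exI[of _ 0])

text \<open>Operations on localisations are unions over representatives; such a union collapses as
  soon as its members are shown to be independent of the representative.\<close>

lemma UN_fr_eq:
  assumes f: "f \<in> polys n" "p \<in> polys n"
    and T: "\<And>q l. q \<in> polys n \<Longrightarrow> fr_rel f p k q l \<Longrightarrow> g (J +>\<^bsub>R\<^esub> q) l = T"
  shows "(\<Union>(u, m)\<in>fr f p k. g u m) = T"
proof -
  have "(case x of (u, m) \<Rightarrow> g u m) = T" if "x \<in> fr f p k" for x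
  proof -
    from that obtain q l where "q \<in> polys n" "x = (J +>\<^bsub>R\<^esub> q, l)" "fr_rel f p k q l"
      unfolding mem_fr_iff[OF f] by blast
    then show ?thesis by (simp add: T)
  qed
  then show ?thesis by (intro UN_constant_eq[OF mem_fr_self[OF f]] ballI)
qed

lemma add_fr:
  assumes f: "f \<in> polys n" and p: "p \<in> polys n" and q: "q \<in> polys n"
  shows "fr f p k \<oplus>\<^bsub>loc f\<^esub> fr f q l = fr f (f ^ l * p + f ^ k * q) (k + l)"
proof -
  have "frac R M f ((f [^]\<^bsub>R\<^esub> l') \<odot>\<^bsub>M\<^esub> (J +>\<^bsub>R\<^esub> p') \<oplus>\<^bsub>M\<^esub> (f [^]\<^bsub>R\<^esub> k') \<odot>\<^bsub>M\<^esub> (J +>\<^bsub>R\<^esub> q')) (k' + l') =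
      fr f (f ^ l * p + f ^ k * q) (k + l)"
    if p': "p' \<in> polys n" "fr_rel f p k p' k'" and q': "q' \<in> polys n" "fr_rel f q l q' l'" for p' k' q' l'
  proof -
    obtain i j where "f ^ (j + k') * p - f ^ (j + k) * p' \<in> J" "f ^ (i + l') * q - f ^ (i + l) * q' \<in> J"
      using p'(2) q'(2) by (auto simp: fr_rel_def)
    \<comment> \<open>The cofactors bring both relations to a shared power of \<open>f\<close>, so
      that their sum is the relation between the two sums of fractions.\<close>
    then have "f ^ (i + l + l') * (f ^ (j + k') * p - f ^ (j + k) * p') +
        f ^ (j + k + k') * (f ^ (i + l') * q - f ^ (i + l) * q') \<in> J"
      using f by (intro J_closed(3) J_closed(6)) auto
    also have "f ^ (i + l + l') * (f ^ (j + k') * p - f ^ (j + k) * p') +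
        f ^ (j + k + k') * (f ^ (i + l') * q - f ^ (i + l) * q') =
        f ^ (i + j + (k' + l')) * (f ^ l * p + f ^ k * q) - f ^ (i + j + (k + l)) * (f ^ l' * p' + f ^ k' * q')"
      by (simp add: algebra_simps power_add)
    finally have "fr f (f ^ l * p + f ^ k * q) (k + l) = fr f (f ^ l' * p' + f ^ k' * q') (k' + l')"
      using f p q p'(1) q'(1) by (subst fr_eq_iff) (auto simp: fr_rel_def)
    then show ?thesis
      using f p'(1) q'(1) by (simp add: fr_def mpoly_ring_nat_pow smult_cls quot_module_simps(3)[OF J])
  qed
  then show ?thesis
    unfolding localisation_def using f p q by (simp add: UN_fr_eq)
qed

lemma add_fr_common:
  assumes "f \<in> polys n" "p \<in> polys n" "q \<in> polys n"
  shows "fr f p k \<oplus>\<^bsub>loc f\<^esub> fr f q k = fr f (p + q) k"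
proof -
  have "fr f (f ^ k * p + f ^ k * q) (k + k) = fr f (p + q) k"
    using fr_scale[of f "p + q" k k] assms by (simp add: distrib_left)
  then show ?thesis using assms by (simp add: add_fr)
qed

lemma smult_fr:
  assumes f: "f \<in> polys n" and a: "a \<in> polys n" and p: "p \<in> polys n"
  shows "a \<odot>\<^bsub>loc f\<^esub> fr f p k = fr f (a * p) k"
proof -
  have "frac R M f (a \<odot>\<^bsub>M\<^esub> (J +>\<^bsub>R\<^esub> q)) l = fr f (a * p) k" if q: "q \<in> polys n" "fr_rel f p k q l" for q l
  proof -
    obtain j where "f ^ (j + l) * p - f ^ (j + k) * q \<in> J" using q(2) by (auto simp: fr_rel_def)
    from J_closed(6)[OF this a] have "f ^ (j + l) * (a * p) - f ^ (j + k) * (a * q) \<in> J"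
      by (simp add: algebra_simps)
    then have "fr f (a * p) k = fr f (a * q) l"
      using f a p q(1) by (subst fr_eq_iff) (auto simp: fr_rel_def)
    then show ?thesis using a q(1) by (simp add: fr_def smult_cls)
  qed
  then show ?thesis
    unfolding localisation_def using f p by (simp add: UN_fr_eq)
qed

lemma loc_map_fr:
  assumes f: "f \<in> polys n" and g: "g \<in> polys n" and p: "p \<in> polys n" and h: "h = g * f"
  shows "loc_map R M g h (fr f p k) = fr h (g ^ k * p) k"
  unfolding loc_map_def
proof (rule UN_fr_eq[OF f p])
  fix q l assume q: "q \<in> polys n" "fr_rel f p k q l"
  obtain j where "f ^ (j + l) * p - f ^ (j + k) * q \<in> J" using q(2) by (auto simp: fr_rel_def)
  \<comment> \<open>This power of \<open>g\<close> completes the powers of \<open>f\<close> in both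
    terms to powers of \<open>h = g * f\<close> and leaves g^k and g^l as the factors
    wanted.\<close>
  then have "g ^ (j + k + l) * (f ^ (j + l) * p - f ^ (j + k) * q) \<in> J"
    using g by (intro J_closed(6)) auto
  also have "g ^ (j + k + l) * (f ^ (j + l) * p - f ^ (j + k) * q) =
      h ^ (j + l) * (g ^ k * p) - h ^ (j + k) * (g ^ l * q)"
    by (simp add: h algebra_simps power_add power_mult_distrib)
  finally have "fr h (g ^ k * p) k = fr h (g ^ l * q) l"
    using f g h p q(1) by (subst fr_eq_iff) (auto simp: fr_rel_def)
  then show "frac R M h ((g [^]\<^bsub>R\<^esub> l) \<odot>\<^bsub>M\<^esub> (J +>\<^bsub>R\<^esub> q)) l = fr h (g ^ k * p) k"
    using g q(1) by (simp add: fr_def mpoly_ring_nat_pow smult_cls)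
qed

lemma zero_loc: "f \<in> polys n \<Longrightarrow> \<zero>\<^bsub>loc f\<^esub> = fr f 0 k"
proof -
  assume f: "f \<in> polys n"
  have "\<zero>\<^bsub>loc f\<^esub> = fr f 0 0" by (simp add: localisation_def fr_def quot_module_simps(2)[OF J])
  also have "\<dots> = fr f 0 k" using fr_scale[of f 0 k 0] f by simp
  finally show ?thesis .
qed

lemma carrier_loc:
  assumes f: "f \<in> polys n"
  shows "carrier (loc f) = {fr f p k | p k. p \<in> polys n}"
  by (auto simp: localisation_def quotient_def fr_def frac_def quot_module_simps(1)[OF J])

text \<open>Makes the rules for finite sums available for the sums in \<open>cech_d\<close>.\<close>

lemma abelian_monoid_loc:
  assumes f: "f \<in> polys n"
  shows "abelian_monoid (loc f)"
proof (rule abelian_monoidI)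
  fix x y assume "x \<in> carrier (loc f)" "y \<in> carrier (loc f)"
  then obtain p k q l where x: "x = fr f p k" "p \<in> polys n" and y: "y = fr f q l" "q \<in> polys n"
    by (auto simp: carrier_loc[OF f])
  show "x \<oplus>\<^bsub>loc f\<^esub> y \<in> carrier (loc f)"
    using x y f by (auto simp: add_fr carrier_loc)
  show "x \<oplus>\<^bsub>loc f\<^esub> y = y \<oplus>\<^bsub>loc f\<^esub> x"
    using x y f by (simp add: add_fr add.commute)
  fix z assume "z \<in> carrier (loc f)"
  then obtain s m where z: "z = fr f s m" "s \<in> polys n" by (auto simp: carrier_loc[OF f])
  have "f ^ m * (f ^ l * p + f ^ k * q) + f ^ (k + l) * s = f ^ (l + m) * p + f ^ k * (f ^ m * q + f ^ l * s)"
    by (simp add: algebra_simps power_add)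
  then show "x \<oplus>\<^bsub>loc f\<^esub> y \<oplus>\<^bsub>loc f\<^esub> z = x \<oplus>\<^bsub>loc f\<^esub> (y \<oplus>\<^bsub>loc f\<^esub> z)"
    using x y z f by (simp add: add_fr add.assoc)
next
  show "\<zero>\<^bsub>loc f\<^esub> \<in> carrier (loc f)" using f by (auto simp: zero_loc[of f 0] carrier_loc)
  fix x assume "x \<in> carrier (loc f)"
  then obtain p k where x: "x = fr f p k" "p \<in> polys n" by (auto simp: carrier_loc[OF f])
  then show "\<zero>\<^bsub>loc f\<^esub> \<oplus>\<^bsub>loc f\<^esub> x = x"
    using f by (simp add: zero_loc[OF f, of k] add_fr_common)
qed

lemma finsum_fr:
  assumes f: "f \<in> polys n" and "finite A" "\<And>i. i \<in> A \<Longrightarrow> p i \<in> polys n"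
  shows "(\<Oplus>\<^bsub>loc f\<^esub>i\<in>A. fr f (p i) k) = fr f (\<Sum>i\<in>A. p i) k"
  using assms(2,3)
proof (induction A)
  interpret L: abelian_monoid "loc f" by (rule abelian_monoid_loc[OF f])
  case empty
  then show ?case using f by (simp add: zero_loc)
next
  interpret L: abelian_monoid "loc f" by (rule abelian_monoid_loc[OF f])
  case (insert j A)
  have "fr f (p i) k \<in> carrier (loc f)" if "i \<in> insert j A" for i
    using insert.prems[OF that] f by (auto simp: carrier_loc)
  then have "(\<Oplus>\<^bsub>loc f\<^esub>i\<in>insert j A. fr f (p i) k) = fr f (p j) k \<oplus>\<^bsub>loc f\<^esub> (\<Oplus>\<^bsub>loc f\<^esub>i\<in>A. fr f (p i) k)"
    using insert.hyps by (intro L.finsum_insert) auto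
  also have "\<dots> = fr f (p j + sum p A) k"
    using insert f by (simp add: add_fr_common polys_sum)
  finally show ?case using insert.hyps by simp
qed

lemma loc_comp_fr:
  "loc_comp R M (quot_comp n J) f d r = {fr f p k | p k. p \<in> polys n \<and> homogeneous (r + int k * int d) p}"
  by (auto simp: loc_comp_def quot_comp_def fr_def)

section \<open>Cech cochains, coboundaries and cohomology as classes of polynomial families\<close>

abbreviation C :: "nat \<Rightarrow> int \<Rightarrow> (nat set \<Rightarrow> ('k mpoly set \<times> nat) set) monoid" where
  "C p r \<equiv> cech R M (quot_comp n J) Var n p r"

definition cls_cochain :: "nat \<Rightarrow> nat \<Rightarrow> (nat set \<Rightarrow> 'k mpoly) \<Rightarrow> nat set \<Rightarrow> ('k mpoly set \<times> nat) set" where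
  "cls_cochain p K u = (\<lambda>F\<in>faces n p. fr (vprod F) (u F) K)"

lemma cls_cochain_scale:
  assumes "cochain n p K r u"
  shows "cls_cochain p (K + a) (\<lambda>F. vprod F ^ a * u F) = cls_cochain p K u"
  unfolding cls_cochain_def
  by (rule restrict_ext, rule fr_scale) (use assms in \<open>simp_all add: cochain_def\<close>)

lemma cls_cochain_eqI:
  assumes "cochain n p K r u" "cochain n p K r v" "\<And>F. F \<in> faces n p \<Longrightarrow> u F - v F \<in> J"
  shows "cls_cochain p K u = cls_cochain p K v"
  unfolding cls_cochain_def
  by (rule restrict_ext, rule fr_eqI) (use assms in \<open>simp_all add: cochain_def\<close>)

lemma carrier_cech:
  "carrier (C p r) = {cls_cochain p K u | K u. cochain n p K r u}"
proof (intro equalityI subsetI)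
  fix c assume "c \<in> carrier (C p r)"
  then have c: "c \<in> (\<Pi>\<^sub>E F\<in>faces n p. loc_comp R M (quot_comp n J) (\<Otimes>\<^bsub>R\<^esub>i\<in>F. Var i) (card F) r)"
    by (simp add: cech_def)
  have "\<exists>q k. c F = fr (vprod F) q k \<and> q \<in> polys n \<and> homogeneous (r + int k * int p) q"
    if F: "F \<in> faces n p" for F
    using PiE_mem[OF c F] finprod_Var[OF F, where 'a = 'k] F by (auto simp: loc_comp_fr faces_def)
  then obtain q k where q: "\<And>F. F \<in> faces n p \<Longrightarrow>
      c F = fr (vprod F) (q F) (k F) \<and> q F \<in> polys n \<and> homogeneous (r + int (k F) * int p) (q F)"
    by metis
  \<comment> \<open>There are finitely many faces, so the sum of their exponents bounds each one and
    serves as the common exponent.\<close>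
  define K where "K = (\<Sum>F\<in>faces n p. k F)"
  define u where "u F = vprod F ^ (K - k F) * q F" for F
  have kK: "k F \<le> K" if "F \<in> faces n p" for F
    unfolding K_def using that finite_faces by (intro member_le_sum) auto
  have "cochain n p K r u"
    unfolding cochain_def
  proof (intro ballI conjI)
    fix F assume F: "F \<in> faces n p"
    show "u F \<in> polys n" using q[OF F] F by (auto simp: u_def)
    have "homogeneous (int (K - k F) * int p + (r + int (k F) * int p)) (u F)"
      unfolding u_def using q[OF F] F by (intro homogeneous_mult homogeneous_power homogeneous_vprod) auto
    then show "homogeneous (r + int K * int p) (u F)"
      using kK[OF F] by (simp add: algebra_simps of_nat_diff)
  qed
  moreover have "c = cls_cochain p K u"
  proof
    fix F
    show "c F = cls_cochain p K u F"
    proof (cases "F \<in> faces n p")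
      case True
      then have "fr (vprod F) (u F) (k F + (K - k F)) = fr (vprod F) (q F) (k F)"
        unfolding u_def using q by (intro fr_scale) auto
      then show ?thesis using True q kK by (simp add: cls_cochain_def)
    next
      case False
      then show ?thesis using PiE_arb[OF c] by (simp add: cls_cochain_def)
    qed
  qed
  ultimately show "c \<in> {cls_cochain p K u | K u. cochain n p K r u}" by blast
next
  fix c assume "c \<in> {cls_cochain p K u | K u. cochain n p K r u}"
  then obtain K u where c: "c = cls_cochain p K u" and u: "cochain n p K r u" by blast
  have "fr (vprod F) (u F) K \<in> loc_comp R M (quot_comp n J) (\<Otimes>\<^bsub>R\<^esub>i\<in>F. Var i) (card F) r"
    if F: "F \<in> faces n p" for F
  proof -
    have "card F = p" using F by (simp add: faces_def)
    then show ?thesis using u F by (auto simp: loc_comp_fr finprod_Var[OF F] cochain_def)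
  qed
  then show "c \<in> carrier (C p r)" by (simp add: cech_def c cls_cochain_def)
qed

lemma mult_cech:
  assumes "cochain n p K r u" "cochain n p K r v"
  shows "cls_cochain p K u \<otimes>\<^bsub>C p s\<^esub> cls_cochain p K v = cls_cochain p K (\<lambda>F. u F + v F)"
  using assms unfolding cech_def cls_cochain_def
  by (auto simp: loc_at_def finprod_Var cochain_def add_fr_common intro!: restrict_ext)

lemma one_cech: "\<one>\<^bsub>C p s\<^esub> = cls_cochain p K (\<lambda>F. 0)"
  unfolding cech_def cls_cochain_def
  by (auto simp: loc_at_def finprod_Var zero_loc[of _ K] intro!: restrict_ext)

lemma cech_d_cls_cochain:
  assumes u: "cochain n p K r u"
  shows "cech_d R M Var n p (cls_cochain p K u) = cls_cochain (Suc p) K (delta K u)"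
  unfolding cech_d_def cls_cochain_def
proof (rule restrict_ext)
  fix G assume G: "G \<in> faces n (Suc p)"
  let ?h = "vprod G"
  have h: "?h \<in> polys n" by (rule vprod_polys[OF G])
  interpret L: abelian_monoid "loc ?h" by (rule abelian_monoid_loc[OF h])
  have neg1: "\<ominus>\<^bsub>R\<^esub> (1 :: 'k mpoly) = - 1" by (simp add: mpoly_ring_a_inv)
  have u': "u (G - {j}) \<in> polys n" "(Var j :: 'k mpoly) \<in> polys n" if "j \<in> G" for j
    using u faces_remove[OF G that] faces_mem[OF G that] by (auto simp: cochain_def)
  have "((\<ominus>\<^bsub>R\<^esub> \<one>\<^bsub>R\<^esub>) [^]\<^bsub>R\<^esub> card {i \<in> G. i < j}) \<odot>\<^bsub>loc ?h\<^esub>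
        loc_map R M (Var j) ?h ((\<lambda>F\<in>faces n p. fr (vprod F) (u F) K) (G - {j})) =
      fr ?h (sgn_at G j * (Var j ^ K * u (G - {j}))) K" if j: "j \<in> G" for j
  proof -
    have "?h = Var j * vprod (G - {j})"
      using prod.remove[OF faces_finite[OF G] j] by simp
    then have "loc_map R M (Var j) ?h (fr (vprod (G - {j})) (u (G - {j})) K) =
        fr ?h (Var j ^ K * u (G - {j})) K"
      using u'[OF j] vprod_polys[OF faces_remove[OF G j]] by (intro loc_map_fr)
    moreover have "(\<ominus>\<^bsub>R\<^esub> \<one>\<^bsub>R\<^esub>) [^]\<^bsub>R\<^esub> card {i \<in> G. i < j} = sgn_at G j"
      by (simp add: neg1 mpoly_ring_nat_pow sgn_at_def)
    moreover have "Var j ^ K * u (G - {j}) \<in> polys n" using u'[OF j] by auto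
    ultimately show ?thesis
      using faces_remove[OF G j] smult_fr[OF h sgn_at_polys[of G j]] by simp
  qed
  then have "(\<Oplus>\<^bsub>loc ?h\<^esub>j\<in>G. ((\<ominus>\<^bsub>R\<^esub> \<one>\<^bsub>R\<^esub>) [^]\<^bsub>R\<^esub> card {i \<in> G. i < j}) \<odot>\<^bsub>loc ?h\<^esub>
        loc_map R M (Var j) ?h ((\<lambda>F\<in>faces n p. fr (vprod F) (u F) K) (G - {j}))) =
      (\<Oplus>\<^bsub>loc ?h\<^esub>j\<in>G. fr ?h (sgn_at G j * (Var j ^ K * u (G - {j}))) K)"
    using u' by (intro L.finsum_cong') (auto simp: carrier_loc[OF h])
  also have "\<dots> = fr ?h (delta K u G) K"
    unfolding delta_def using u' by (intro finsum_fr[OF h faces_finite[OF G]]) auto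
  finally show "(\<Oplus>\<^bsub>loc_at R M Var G\<^esub>j\<in>G. ((\<ominus>\<^bsub>R\<^esub> \<one>\<^bsub>R\<^esub>) [^]\<^bsub>R\<^esub> card {i \<in> G. i < j})
        \<odot>\<^bsub>loc_at R M Var G\<^esub> loc_map R M (Var j) (\<Otimes>\<^bsub>R\<^esub>i\<in>G. Var i)
          ((\<lambda>F\<in>faces n p. fr (vprod F) (u F) K) (G - {j}))) = fr (vprod G) (delta K u G) K"
    by (simp add: loc_at_def finprod_Var[OF G])
qed

lemma coboundaries_Suc:
  "coboundaries R M (quot_comp n J) Var n (Suc q) r = {cls_cochain (Suc q) K (delta K v) | K v. cochain n q K r v}"
proof -
  have "cech_d R M Var n q ` {cls_cochain q K v | K v. cochain n q K r v} =
      {cech_d R M Var n q (cls_cochain q K v) | K v. cochain n q K r v}"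
    by blast
  also have "\<dots> = {cls_cochain (Suc q) K (delta K v) | K v. cochain n q K r v}"
    by (intro Collect_cong) (metis cech_d_cls_cochain)
  finally show ?thesis by (simp add: coboundaries_def carrier_cech)
qed

text \<open>Elements of \<open>H_m\<close> are right cosets of the coboundaries, so the class of a
  coboundary is trivial once translation by it maps the coboundaries onto themselves. Preimages are
  differences, formed at the common exponent \<open>K + L\<close>.\<close>

lemma coboundaries_coset:
  assumes a: "a \<in> coboundaries R M (quot_comp n J) Var n p r"
  shows "(\<lambda>h. h \<otimes>\<^bsub>C p r\<^esub> a) ` coboundaries R M (quot_comp n J) Var n p r =
    coboundaries R M (quot_comp n J) Var n p r"
proof (cases p)
  case 0
  have "cochain n 0 0 r (\<lambda>F. 0)" by (simp add: cochain_def)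
  from mult_cech[OF this this, of r] have "\<one>\<^bsub>C 0 r\<^esub> \<otimes>\<^bsub>C 0 r\<^esub> \<one>\<^bsub>C 0 r\<^esub> = \<one>\<^bsub>C 0 r\<^esub>"
    by (simp add: one_cech[of 0 _ 0])
  then show ?thesis using a 0 by (simp add: coboundaries_def)
next
  case (Suc q)
  let ?B = "coboundaries R M (quot_comp n J) Var n (Suc q) r"
  obtain L w where w: "cochain n q L r w" "a = cls_cochain (Suc q) L (delta L w)"
    using a Suc by (auto simp: coboundaries_Suc)
  have scaled: "cochain n q (K + e) r (\<lambda>F. vprod F ^ e * v F)"
      "cls_cochain (Suc q) K (delta K v) = cls_cochain (Suc q) (K + e) (delta (K + e) (\<lambda>F. vprod F ^ e * v F))"
    if v: "cochain n q K r v" for K e v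
  proof -
    show "cochain n q (K + e) r (\<lambda>F. vprod F ^ e * v F)" by (rule cochain_scale[OF v])
    have "cls_cochain (Suc q) (K + e) (delta (K + e) (\<lambda>F. vprod F ^ e * v F)) =
        cls_cochain (Suc q) (K + e) (\<lambda>G. vprod G ^ e * delta K v G)"
      unfolding cls_cochain_def by (rule restrict_ext) (simp add: delta_scale faces_finite)
    then show "cls_cochain (Suc q) K (delta K v) =
        cls_cochain (Suc q) (K + e) (delta (K + e) (\<lambda>F. vprod F ^ e * v F))"
      by (simp add: cls_cochain_scale[OF delta_cochain[OF v]])
  qed
  have add: "cls_cochain (Suc q) K (delta K v) \<otimes>\<^bsub>C (Suc q) r\<^esub> cls_cochain (Suc q) K (delta K v') =
      cls_cochain (Suc q) K (delta K (\<lambda>F. v F + v' F))"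
    if "cochain n q K r v" "cochain n q K r v'" for K v v'
    using mult_cech[OF delta_cochain[OF that(1)] delta_cochain[OF that(2)], of r]
    by (simp only: delta_add)
  have "\<exists>h'\<in>?B. h' \<otimes>\<^bsub>C (Suc q) r\<^esub> a = h" "h \<otimes>\<^bsub>C (Suc q) r\<^esub> a \<in> ?B" if h: "h \<in> ?B" for h
  proof -
    obtain K v where v: "cochain n q K r v" "h = cls_cochain (Suc q) K (delta K v)"
      using h by (auto simp: coboundaries_Suc)
    define v' w' where "v' = (\<lambda>F. vprod F ^ L * v F)" and "w' = (\<lambda>F. vprod F ^ K * w F)"
    have v': "cochain n q (K + L) r v'" "h = cls_cochain (Suc q) (K + L) (delta (K + L) v')"
      using scaled[OF v(1)] v(2) by (simp_all add: v'_def)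
    have w': "cochain n q (K + L) r w'" "a = cls_cochain (Suc q) (K + L) (delta (K + L) w')"
      using scaled[OF w(1), of K] w(2) by (simp_all add: w'_def add.commute)
    have d: "cochain n q (K + L) r (\<lambda>F. v' F - w' F)" by (rule cochain_diff[OF v'(1) w'(1)])
    have s: "cochain n q (K + L) r (\<lambda>F. v' F + w' F)" using v'(1) w'(1) by (auto simp: cochain_def)
    show "h \<otimes>\<^bsub>C (Suc q) r\<^esub> a \<in> ?B"
      unfolding v'(2) w'(2) add[OF v'(1) w'(1)] coboundaries_Suc using s by blast
    show "\<exists>h'\<in>?B. h' \<otimes>\<^bsub>C (Suc q) r\<^esub> a = h"
      unfolding v'(2) w'(2) coboundaries_Suc using add[OF d w'(1)] d
      by (intro bexI[of _ "cls_cochain (Suc q) (K + L) (delta (K + L) (\<lambda>F. v' F - w' F))"]) auto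
  qed
  then show ?thesis unfolding Suc by (auto simp: image_iff)
qed

lemma cocycle_coboundary:
  assumes ex: "exact_at n J p r" and c: "c \<in> cocycles R M (quot_comp n J) Var n p r"
  shows "c \<in> coboundaries R M (quot_comp n J) Var n p r"
proof -
  obtain K u where u: "cochain n p K r u" and cu: "c = cls_cochain p K u"
    and d: "cech_d R M Var n p c = \<one>\<^bsub>C (Suc p) r\<^esub>"
    using c by (auto simp: cocycles_def carrier_cech)
  have eq: "cls_cochain (Suc p) K (delta K u) = cls_cochain (Suc p) K (\<lambda>F. 0)"
    using d by (simp add: cu cech_d_cls_cochain[OF u] one_cech[of _ _ K])
  \<comment> \<open>Vanishing in the localisation puts the differential into \<open>J\<close> only
    after multiplication by a power of x_G that depends on \<open>G\<close>.\<close>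
  have "\<exists>N. vprod G ^ N * delta K u G \<in> J" if G: "G \<in> faces n (Suc p)" for G
  proof -
    have "fr (vprod G) (delta K u G) K = fr (vprod G) 0 K"
      using fun_cong[OF eq, of G] G by (simp add: cls_cochain_def)
    moreover have "delta K u G \<in> polys n" using delta_cochain[OF u] G by (simp add: cochain_def)
    ultimately show ?thesis using G by (auto simp: fr_eq_iff fr_rel_def)
  qed
  then obtain N where N: "\<And>G. G \<in> faces n (Suc p) \<Longrightarrow> vprod G ^ N G * delta K u G \<in> J" by metis
  \<comment> \<open>One exponent that works for all faces; after scaling by it the cocycle condition
    holds in \<open>J\<close>, as \<open>exact_at\<close> demands.\<close>
  define e where "e = (\<Sum>G\<in>faces n (Suc p). N G)"
  define u' where "u' = (\<lambda>F. vprod F ^ e * u F)"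
  have u': "cochain n p (K + e) r u'" unfolding u'_def by (rule cochain_scale[OF u])
  have "delta (K + e) u' G \<in> J" if G: "G \<in> faces n (Suc p)" for G
  proof -
    have "N G \<le> e" unfolding e_def using G finite_faces by (intro member_le_sum) auto
    then have "vprod G ^ e * delta K u G = vprod G ^ (e - N G) * (vprod G ^ N G * delta K u G)"
      by (simp flip: mult.assoc power_add)
    moreover have "vprod G ^ (e - N G) * (vprod G ^ N G * delta K u G) \<in> J"
      using G by (intro J_closed(6) N) auto
    ultimately have "vprod G ^ e * delta K u G \<in> J" by (simp only:)
    then show ?thesis unfolding u'_def delta_scale[OF faces_finite[OF G]] .
  qed
  with ex u' have "coboundary n J p (K + e) r u'" by (simp add: exact_at_def)
  then obtain b v where v: "\<And>q. p = Suc q \<Longrightarrow> cochain n q (K + e + b) r v"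
    and uv: "\<And>F. F \<in> faces n p \<Longrightarrow> vprod F ^ b * u' F - delta (K + e + b) v F \<in> J"
    unfolding coboundary_def by blast
  let ?L = "K + e + b"
  have dv: "cochain n p ?L r (delta ?L v)"
  \<comment> \<open>For \<open>p = 0\<close> nothing is known about \<open>v\<close>, but its
    differential over the empty face is 0.\<close>
  proof (cases p)
    case 0
    then show ?thesis by (simp add: cochain_def faces_zero delta_def)
  next
    case (Suc q)
    then show ?thesis using delta_cochain[OF v[OF Suc]] by simp
  qed
  have "c = cls_cochain p ?L (\<lambda>F. vprod F ^ b * u' F)"
    unfolding cu using cls_cochain_scale[OF u', of b] cls_cochain_scale[OF u, of e] by (simp add: u'_def)
  also have "\<dots> = cls_cochain p ?L (delta ?L v)"
    using uv by (intro cls_cochain_eqI[OF cochain_scale[OF u'] dv])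
  finally have c: "c = cls_cochain p ?L (delta ?L v)" .
  show ?thesis
  proof (cases p)
    case 0
    have "cls_cochain 0 ?L (delta ?L v) = cls_cochain 0 ?L (\<lambda>F. 0)"
      unfolding cls_cochain_def by (rule restrict_ext) (simp add: faces_zero delta_def)
    then show ?thesis using c 0 by (simp add: coboundaries_def one_cech[of 0 _ ?L])
  next
    case (Suc q)
    have "c = cls_cochain (Suc q) ?L (delta ?L v)" using c by (simp only: Suc)
    with v[OF Suc] show ?thesis unfolding Suc coboundaries_Suc by blast
  qed
qed

proposition H_m_trivial:
  assumes ex: "exact_at n J p r"
  shows "carrier (H_m n J p r) = {\<one>\<^bsub>H_m n J p r\<^esub>}"
proof -
  let ?B = "coboundaries R M (quot_comp n J) Var n p r" and ?Z = "cocycles R M (quot_comp n J) Var n p r"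
  let ?C = "(C p r)\<lparr>carrier := ?Z\<rparr>"
  have "?B #>\<^bsub>?C\<^esub> a = ?B" if "a \<in> ?Z" for a
  proof -
    have "?B #>\<^bsub>?C\<^esub> a = (\<lambda>h. h \<otimes>\<^bsub>C p r\<^esub> a) ` ?B" by (auto simp: r_coset_def)
    then show ?thesis using coboundaries_coset[OF cocycle_coboundary[OF ex that]] by simp
  qed
  \<comment> \<open>If there were no cocycles there would be no cosets either, and the carrier would
    be empty instead of a singleton.\<close>
  moreover have "?Z \<noteq> {}"
  proof -
    have z: "cochain n p 0 r (\<lambda>F. 0)" by (simp add: cochain_def)
    have "delta 0 (\<lambda>F. 0 :: 'k mpoly) = (\<lambda>F. 0)" by (simp add: delta_def fun_eq_iff)
    then have "cls_cochain p 0 (\<lambda>F. 0) \<in> ?Z"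
      using z cech_d_cls_cochain[OF z] by (auto simp: cocycles_def carrier_cech one_cech[of _ _ 0])
    then show ?thesis by blast
  qed
  ultimately have "rcosets\<^bsub>?C\<^esub> ?B = {?B}" by (auto simp: RCOSETS_def)
  then show ?thesis by (simp add: H_m_def local_cohomology_def FactGroup_def)
qed

end

section \<open>The bound on the partial regularity\<close>

theorem corollary4p4:
  fixes I :: "('k::field) mpoly set" and n t :: nat
  assumes "homogeneous_ideal n I"
    and "t < n"
    and "filter_regular n I (map (\<lambda>i. Var (n - i)) [0..<Suc t])"
  shows "reg_partial n I t
           \<le> ereal (real_of_int
               (Max ((\<lambda>i. int (mdeg (gen_lcm n I i)) - int n + int i) ` {0..t})))"
proof -
  define B where "B = Max ((\<lambda>i. int (mdeg (gen_lcm n I i)) - int n + int i) ` {0..t})"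
  have I: "ideal I (mpoly_ring n)" using assms(1) by (simp add: homogeneous_ideal_def)
  interpret mpoly_quotient n I by (rule mpoly_quotient.intro[OF I])
  have reg: "regular_above n (cut_ideal n I i) (n - i) B" if i: "i \<le> t" for i
  proof -
    have "int (mdeg (gen_lcm n I i)) - int n + int i \<le> B"
      unfolding B_def using i by (intro Max_ge) auto
    then show ?thesis
      using regular_above_cut[OF assms i] unfolding regular_above_def by force
  qed
  have vanish: "carrier (H_m n I p r) = {\<one>\<^bsub>H_m n I p r\<^esub>}" if p: "p \<le> t" "r + int p > B" for p r
  proof (rule H_m_trivial)
    \<comment> \<open>An ideal is required at every index, while \<open>cut_ideal\<close> beyond
      index \<open>n\<close> would adjoin the variable with index 0, which is not in S; hence the
      cap at \<open>n\<close>.\<close>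
    define Q where "Q i = cut_ideal n I (min i n)" for i
    have "exact_at n (Q 0) p r"
    proof (rule exact_at_of_regular_above[where t = t and x = "\<lambda>i. n - i" and B = B])
      show "ideal (Q i) (mpoly_ring n)" for i unfolding Q_def using ideal_cut_ideal[OF I] by simp
      show "graded (Q i)" for i
        unfolding Q_def by (intro graded_cut_ideal homogeneous_ideal_graded[OF assms(1)])
      show "Q (Suc i) = ideal_plus n (Q i) (Var (n - i))" if "i \<le> t" for i
        using that assms(2) by (simp add: Q_def min_def)
      show "regular_above n (Q i) (n - i) B" if "i \<le> t" for i
        using reg[OF that] that assms(2) by (simp add: Q_def min_def)
    qed (use p assms(2) in auto)
    then show "exact_at n I p r" by (simp add: Q_def)
  qed
  have "a_inv_coh n I p + ereal (real p) \<le> ereal (real_of_int B)" if p: "p \<le> t" for p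
  proof -
    have "a_inv_coh n I p \<le> ereal (real_of_int (B - int p))"
      unfolding a_inv_coh_def
    \<comment> \<open>Bounding each nonzero degree also settles a vanishing cohomology module, since
      the supremum of the empty set is minus infinity.\<close>
    proof (rule SUP_least)
      fix r assume "r \<in> {r. carrier (H_m n I p r) \<noteq> {\<one>\<^bsub>H_m n I p r\<^esub>}}"
      then have "\<not> r + int p > B" using vanish[OF p] by blast
      then show "ereal (real_of_int r) \<le> ereal (real_of_int (B - int p))" by simp
    qed
    then have "a_inv_coh n I p + ereal (real p) \<le> ereal (real_of_int (B - int p)) + ereal (real p)"
      by (rule add_right_mono)
    then show ?thesis by simp
  qed
  then show ?thesis
    unfolding reg_partial_def B_def[symmetric] by (subst Max_le_iff) auto
qed

end
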